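(* Let $D$ be the open unit disc in $\mathbb{C}$, let $a,b\in D\setminus\{0\}$ with $a\neq b$, and let $A=\{((a,0),1),((b,0),2)\}$ (pole $(a,0)$ with weight $1$, pole $(b,0)$ with weight $2$). There exist strictly convex domains $\Omega$ with smooth boundary, contained in the bidisc $D\times D\subset\mathbb{C}^2$ and containing the points $(a,0)$ and $(b,0)$, such that $g_\Omega(\cdot,A)\not\equiv\delta_\Omega(\cdot,A)$ on $\Omega$.
   Context: Let $\Omega\subset\mathbb{C}^n$ be a domain and $A=\{(w_1,\nu_1),\ldots,(w_k,\nu_k)\}\subset\Omega\times[0,\infty)$ with distinct poles $w_j$ and weights $\nu_j$. Pluricomplex Green function: $g_\Omega(z,A)=\sup\{u(z)\}$, the supremum being over all plurisubharmonic functions $u\le 0$ on $\Omega$ such that for each $j$ there is a constant $C_u$ with $u(\zeta)-\nu_j\log|\zeta-w_j|\le C_u$ for $\zeta$ near $w_j$. Lempert function: for $z\in\Omega$, let $F_z$ be the family of holomorphic maps $f:D\to\Omega$ with $f(0)=z$ for which there exist $\zeta_1,\ldots,\zeta_k\in D$ with $f(\zeta_j)=w_j$ for $j=1,\ldots,k$; put $d(f)=\sum_{j=1}^k\nu_j\log|\zeta_j|$. Then $\delta_\Omega(z,A)=\inf d(f)$, the infimum being over all $f\in F_z$ (and all admissible choices of the $\zeta_j$), with $\log 0=-\infty$. *)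

theory Defs
  imports "HOL-Complex_Analysis.Complex_Analysis"
begin

definition is_domain :: "'a::topological_space set \<Rightarrow> bool" where
  "is_domain \<Omega> \<longleftrightarrow> open \<Omega> \<and> connected \<Omega> \<and> \<Omega> \<noteq> {}"

definition strictly_convex :: "'a::real_normed_vector set \<Rightarrow> bool" where
  "strictly_convex S \<longleftrightarrow>
     (\<forall>x\<in>closure S. \<forall>y\<in>closure S. x \<noteq> y \<longrightarrow> open_segment x y \<subseteq> interior S)"

fun Ck_on :: "nat \<Rightarrow> ('a::real_normed_vector \<Rightarrow> 'b::real_normed_vector) \<Rightarrow> 'a set \<Rightarrow> bool" where
  "Ck_on 0 f U \<longleftrightarrow> continuous_on U f"
| "Ck_on (Suc k) f U \<longleftrightarrow>
     (\<forall>x\<in>U. f differentiable (at x)) \<and> (\<forall>v. Ck_on k (\<lambda>x. frechet_derivative f (at x) v) U)"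

definition smooth_on :: "('a::real_normed_vector \<Rightarrow> 'b::real_normed_vector) \<Rightarrow> 'a set \<Rightarrow> bool" where
  "smooth_on f U \<longleftrightarrow> (\<forall>k. Ck_on k f U)"

definition smooth_boundary :: "'a::real_normed_vector set \<Rightarrow> bool" where
  "smooth_boundary \<Omega> \<longleftrightarrow>
     (\<forall>p\<in>frontier \<Omega>. \<exists>U (\<rho>::'a \<Rightarrow> real). open U \<and> p \<in> U \<and> smooth_on \<rho> U \<and>
        frechet_derivative \<rho> (at p) \<noteq> (\<lambda>_. 0) \<and> \<Omega> \<inter> U = {x\<in>U. \<rho> x < 0})"

definition usc_on :: "'a::topological_space set \<Rightarrow> ('a \<Rightarrow> ereal) \<Rightarrow> bool" where
  "usc_on S u \<longleftrightarrow> (\<forall>c. openin (top_of_set S) {x\<in>S. u x < c})"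

text \<open>
  The mean value is the integral of the positive part minus the integral of the negative part
  (\<^term>\<open>e2ennreal\<close> sends negative numbers to 0). For an upper semicontinuous
  \<open>u < \<infinity>\<close> the first integral is finite, so the difference is never
  \<open>\<infinity> - \<infinity>\<close>.
\<close>

definition circle_mean :: "(complex \<Rightarrow> ereal) \<Rightarrow> complex \<Rightarrow> real \<Rightarrow> ereal" where
  "circle_mean u c r =
     (enn2ereal (\<integral>\<^sup>+ t\<in>{0..2*pi}. e2ennreal (u (c + of_real r * cis t)) \<partial>lborel) -
      enn2ereal (\<integral>\<^sup>+ t\<in>{0..2*pi}. e2ennreal (- u (c + of_real r * cis t)) \<partial>lborel)) /
     ereal (2 * pi)"

text \<open>
  The function that is constantly \<open>- \<infinity>\<close> counts as subharmonic and plurisubharmonic.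
\<close>

definition subharmonic_on :: "complex set \<Rightarrow> (complex \<Rightarrow> ereal) \<Rightarrow> bool" where
  "subharmonic_on U u \<longleftrightarrow>
     (\<forall>z\<in>U. u z < \<infinity>) \<and> usc_on U u \<and>
     (\<forall>c r. 0 < r \<and> cball c r \<subseteq> U \<longrightarrow> u c \<le> circle_mean u c r)"

definition plurisubharmonic_on :: "(complex^'n) set \<Rightarrow> (complex^'n \<Rightarrow> ereal) \<Rightarrow> bool" where
  "plurisubharmonic_on \<Omega> u \<longleftrightarrow>
     (\<forall>z\<in>\<Omega>. u z < \<infinity>) \<and> usc_on \<Omega> u \<and>
     (\<forall>z v. subharmonic_on {t. z + t *s v \<in> \<Omega>} (\<lambda>t. u (z + t *s v)))"

text \<open>
  A weighted pole set is a finite set of pairs (pole, weight) with distinct poles.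
  The filter \<open>at w\<close> omits the pole \<open>w\<close> itself, where
  \<open>u w - \<nu> * log 0\<close> would be undefined; an upper semicontinuous function satisfying the
  estimate off \<open>w\<close> and the submean inequality has \<open>u w = - \<infinity>\<close> if
  \<open>\<nu> > 0\<close>.
\<close>

definition green_family ::
    "(complex^'n) set \<Rightarrow> ((complex^'n) \<times> real) set \<Rightarrow> (complex^'n \<Rightarrow> ereal) set" where
  "green_family \<Omega> A =
     {u. plurisubharmonic_on \<Omega> u \<and> (\<forall>z\<in>\<Omega>. u z \<le> 0) \<and>
         (\<forall>(w, \<nu>)\<in>A. \<exists>C::real. \<forall>\<^sub>F \<zeta> in at w. u \<zeta> - ereal (\<nu> * ln (norm (\<zeta> - w))) \<le> ereal C)}"

definition green_function ::
    "(complex^'n) set \<Rightarrow> ((complex^'n) \<times> real) set \<Rightarrow> complex^'n \<Rightarrow> ereal" where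
  "green_function \<Omega> A z = (SUP u\<in>green_family \<Omega> A. u z)"

definition log_ereal :: "real \<Rightarrow> ereal" where
  "log_ereal x = (if x = 0 then - \<infinity> else ereal (ln x))"

definition lempert_discs ::
    "(complex^'n) set \<Rightarrow> ((complex^'n) \<times> real) set \<Rightarrow> complex^'n \<Rightarrow>
     ((complex \<Rightarrow> complex^'n) \<times> ((complex^'n) \<times> real \<Rightarrow> complex)) set" where
  "lempert_discs \<Omega> A z =
     {(f, \<zeta>). (\<forall>i. (\<lambda>t. f t $ i) holomorphic_on ball 0 1) \<and> f ` ball 0 1 \<subseteq> \<Omega> \<and> f 0 = z \<and>
        (\<forall>p\<in>A. \<zeta> p \<in> ball 0 1 \<and> f (\<zeta> p) = fst p)}"

definition lempert_function ::
    "(complex^'n) set \<Rightarrow> ((complex^'n) \<times> real) set \<Rightarrow> complex^'n \<Rightarrow> ereal" where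
  "lempert_function \<Omega> A z =
     (INF (f, \<zeta>)\<in>lempert_discs \<Omega> A z. \<Sum>p\<in>A. ereal (snd p) * log_ereal (norm (\<zeta> p)))"

end

theory Submission
  imports Defs
begin

text \<open>
  The reason for the strict inequality is visible already in the bidisc, at a point
  \<open>(a, w)\<close> above the pole of weight 1, with \<open>w > 0\<close> small.  Let \<open>\<beta> < 1\<close> be the
  pseudohyperbolic distance of \<open>a\<close> and \<open>b\<close>.

  For the Green function one may use many discs one after the other.  Discs through \<open>(b, 0)\<close>
  show that every competitor is at most \<open>2 * ln \<beta>\<close> on the punctured disc of radius
  \<open>\<beta>\<close> in the line over \<open>a\<close>; the pole at the centre of that disc then gives the value
  \<open>ln (w / \<beta>) + 2 * ln \<beta> = ln (w * \<beta>)\<close> as an upper bound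
  (\<open>green_function_upper_bound\<close>).

  For the Lempert function a single disc must meet both poles, at parameters \<open>p\<close> and \<open>q\<close>
  say.  The Schwarz lemma with two zeros gives \<open>w \<le> norm p * norm q\<close> from the second
  component and \<open>\<beta> \<le> norm q * \<rho>(p, q)\<close>, with the pseudohyperbolic distance
  \<open>\<rho>\<close>, from the first.  For small \<open>w\<close> this forces
  \<open>norm p * (norm q)\<^sup>2 \<ge> w * \<theta>\<close> for any prescribed \<open>\<theta> < sqrt \<beta>\<close>
  (\<open>lempert_function_lower_bound\<close>), and \<open>\<theta>\<close> can be taken larger than \<open>\<beta>\<close>.

  The gap survives the passage to a strictly convex domain
  \<open>{z. norm (z $ 1) ^ (2 * m) + norm (z $ 2) ^ (2 * m) < 1}\<close> with large \<open>m\<close>.  The lower bound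
  for the Lempert function is inherited by subdomains of the bidisc, and the discs used for the upper
  bound fit into the domain after shrinking them by a factor \<open>r\<close> close to 1.

  The analytic core is \<open>green_family_disc_bound\<close>: a plurisubharmonic function, known to satisfy
  the submean inequality only on complex lines, obeys the maximum principle along a holomorphic disc.
  In place of a regularisation, a maximum in a neighbourhood of the disc, with a large multiple of the
  squared deviation from the disc as a penalty, is tested on the complex tangent line; as the
  deviation is holomorphic along that line, the squared deviation has no Laplacian at the touching
  point (\<open>plurisubharmonic_no_touching\<close>).
\<close>

section \<open>Subharmonic functions and circle means\<close>

lemma holomorphic_circle_average:
  assumes "G holomorphic_on cball c r" and "0 < r"
  shows "((\<lambda>t. G (c + of_real r * cis t)) has_integral (2 * of_real pi * G c)) {0..2*pi}"
proof -
  have "((\<lambda>u. G u / (u - c)) has_contour_integral (2 * of_real pi * \<i> * G c)) (circlepath c r)"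
    using assms by (intro Cauchy_integral_circlepath_simple) auto
  then have "((\<lambda>t. G (c + r * cis t) / (c + r * cis t - c) * r * \<i> * cis t)
      has_integral (2 * of_real pi * \<i> * G c)) {0..2*pi}"
    unfolding circlepath_def by (subst (asm) has_contour_integral_part_circlepath_iff) auto
  moreover have "(\<lambda>t. G (c + r * cis t) / (c + r * cis t - c) * r * \<i> * cis t)
      = (\<lambda>t. \<i> * G (c + of_real r * cis t))"
    using assms(2) by (auto simp: field_simps)
  ultimately have "((\<lambda>t. \<i> * G (c + of_real r * cis t)) has_integral (\<i> * (2 * of_real pi * G c))) {0..2*pi}"
    by (simp add: algebra_simps)
  then have "((\<lambda>t. (- \<i>) * (\<i> * G (c + of_real r * cis t))) has_integral (- \<i>) * (\<i> * (2 * of_real pi * G c))) {0..2*pi}"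
    by (rule has_integral_mult_right)
  then show ?thesis
    by (simp add: mult.assoc [symmetric])
qed

text \<open>
The two nonnegative integrals are monotone in the integrand whether or not \<open>v\<close> is
measurable; for the continuous \<open>h\<close> both parts are finite and
their difference is the ordinary integral.
\<close>

lemma circle_mean_le:
  fixes h :: "real \<Rightarrow> real"
  assumes le: "\<And>t. t \<in> {0..2*pi} \<Longrightarrow> v (c + of_real r * cis t) \<le> ereal (h t)"
    and cont: "continuous_on {0..2*pi} h"
  shows "circle_mean v c r \<le> ereal (integral {0..2*pi} h / (2*pi))"
proof -
  let ?I = "{0..2*pi}"
  let ?w = "\<lambda>t. v (c + of_real r * cis t)"
  have part: "(\<integral>\<^sup>+ t\<in>?I. ennreal (g t) \<partial>lborel) = ennreal (integral ?I (\<lambda>t. max (g t) 0))"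
    if g: "continuous_on ?I g" for g :: "real \<Rightarrow> real"
  proof -
    have c: "continuous_on ?I (\<lambda>t. max (g t) 0)"
      using g by (intro continuous_intros)
    then have si: "set_integrable lborel ?I (\<lambda>t. max (g t) 0)"
      by (rule borel_integrable_atLeastAtMost')
    have "(\<integral>\<^sup>+ t\<in>?I. ennreal (g t) \<partial>lborel)
        = (\<integral>\<^sup>+ t. ennreal (indicat_real ?I t *\<^sub>R max (g t) 0) \<partial>lborel)"
      by (intro nn_integral_cong) (auto simp: indicator_def max_def ennreal_neg)
    also have "\<dots> = ennreal (set_lebesgue_integral lborel ?I (\<lambda>t. max (g t) 0))"
      unfolding set_lebesgue_integral_def
      by (rule nn_integral_eq_integral [OF si [unfolded set_integrable_def]]) (auto simp: indicator_def)
    also have "set_lebesgue_integral lborel ?I (\<lambda>t. max (g t) 0) = integral ?I (\<lambda>t. max (g t) 0)"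
      using si by (rule set_borel_integral_eq_integral(2))
    finally show ?thesis .
  qed
  have pos: "enn2ereal (\<integral>\<^sup>+ t\<in>?I. e2ennreal (?w t) \<partial>lborel) \<le> ereal (integral ?I (\<lambda>t. max (h t) 0))"
  proof -
    have "(\<integral>\<^sup>+ t\<in>?I. e2ennreal (?w t) \<partial>lborel) \<le> (\<integral>\<^sup>+ t\<in>?I. ennreal (h t) \<partial>lborel)"
    proof (intro nn_integral_mono)
      fix t
      show "e2ennreal (?w t) * indicator ?I t \<le> ennreal (h t) * indicator ?I t"
        using le[of t] e2ennreal_mono[of "?w t" "ereal (h t)"]
        unfolding e2ennreal_ereal by (cases "t \<in> ?I") simp_all
    qed
    then have "(\<integral>\<^sup>+ t\<in>?I. e2ennreal (?w t) \<partial>lborel) \<le> ennreal (integral ?I (\<lambda>t. max (h t) 0))"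
      unfolding part[OF cont] .
    moreover have "0 \<le> integral ?I (\<lambda>t. max (h t) 0)"
      by (rule integral_nonneg) (intro integrable_continuous_interval continuous_intros cont, simp)
    ultimately show ?thesis
      by (simp add: less_eq_ennreal.rep_eq enn2ereal_ennreal)
  qed
  have neg: "ereal (integral ?I (\<lambda>t. max (- h t) 0)) \<le> enn2ereal (\<integral>\<^sup>+ t\<in>?I. e2ennreal (- ?w t) \<partial>lborel)"
  proof -
    have "(\<integral>\<^sup>+ t\<in>?I. ennreal (- h t) \<partial>lborel) \<le> (\<integral>\<^sup>+ t\<in>?I. e2ennreal (- ?w t) \<partial>lborel)"
    proof (intro nn_integral_mono)
      fix t
      show "ennreal (- h t) * indicator ?I t \<le> e2ennreal (- ?w t) * indicator ?I t"
        using ereal_minus_le_minus[THEN iffD2, OF le[of t]] e2ennreal_mono[of "ereal (- h t)" "- ?w t"]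
        unfolding e2ennreal_ereal by (cases "t \<in> ?I") simp_all
    qed
    moreover have "continuous_on ?I (\<lambda>t. - h t)"
      using cont by (intro continuous_intros)
    ultimately have "ennreal (integral ?I (\<lambda>t. max (- h t) 0)) \<le> (\<integral>\<^sup>+ t\<in>?I. e2ennreal (- ?w t) \<partial>lborel)"
      by (simp only: part)
    moreover have "0 \<le> integral ?I (\<lambda>t. max (- h t) 0)"
      by (rule integral_nonneg) (intro integrable_continuous_interval continuous_intros cont, simp)
    ultimately show ?thesis
      by (simp add: less_eq_ennreal.rep_eq enn2ereal_ennreal)
  qed
  have "integral ?I (\<lambda>t. max (h t) 0) - integral ?I (\<lambda>t. max (- h t) 0)
      = integral ?I (\<lambda>t. max (h t) 0 - max (- h t) 0)"
    by (rule Henstock_Kurzweil_Integration.integral_diff [symmetric])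
       (intro integrable_continuous_interval continuous_intros cont)+
  also have "\<dots> = integral ?I h"
    by (rule arg_cong [where f = "integral ?I"]) (auto simp: max_def)
  finally have "enn2ereal (\<integral>\<^sup>+ t\<in>?I. e2ennreal (?w t) \<partial>lborel) - enn2ereal (\<integral>\<^sup>+ t\<in>?I. e2ennreal (- ?w t) \<partial>lborel)
      \<le> ereal (integral ?I h)"
    using ereal_minus_mono[OF pos neg] by simp
  then have "circle_mean v c r \<le> ereal (integral ?I h) / ereal (2*pi)"
    unfolding circle_mean_def by (intro ereal_divide_right_mono) auto
  then show ?thesis by simp
qed

text \<open>
The mean of \<open>Re G\<close> over a circle about 0 is its value at 0, so the quadratic term pushes the
mean of \<open>v\<close> strictly below \<open>v 0\<close>.  This is the form in which the submean inequality is
used: it rules out certain upper test functions.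
\<close>

lemma subharmonic_no_strict_touching:
  assumes sub: "subharmonic_on U v" and U: "ball 0 R \<subseteq> U" and "0 < R" "0 < k"
    and G: "G holomorphic_on ball 0 R"
    and le: "\<And>t. t \<in> ball 0 R \<Longrightarrow> v t \<le> ereal (Re (G t) - k * (norm t)\<^sup>2)"
    and eq: "v 0 = ereal (Re (G 0))"
  shows False
proof -
  define r where "r = R / 2"
  have r: "0 < r" "cball 0 r \<subseteq> ball (0::complex) R"
    using \<open>0 < R\<close> by (auto simp: r_def)
  let ?h = "\<lambda>t. Re (G (0 + of_real r * cis t)) - k * r\<^sup>2"
  have hol: "G holomorphic_on cball 0 r"
    using G r(2) by (rule holomorphic_on_subset)
  have "((\<lambda>t. Re (G (0 + of_real r * cis t))) has_integral Re (2 * of_real pi * G 0)) {0..2*pi}"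
    using holomorphic_circle_average[OF hol r(1)] by (rule has_integral_Re)
  from has_integral_diff[OF this has_integral_const_real[of "k * r\<^sup>2"]]
  have I: "integral {0..2*pi} ?h = 2 * pi * Re (G 0) - 2 * pi * (k * r\<^sup>2)"
    by (intro integral_unique) auto
  have "continuous_on {0..2*pi} (\<lambda>t. G (0 + of_real r * cis t))"
    using r by (intro continuous_on_compose2[OF holomorphic_on_imp_continuous_on[OF hol]] continuous_intros)
      (auto simp: norm_mult)
  then have cont: "continuous_on {0..2*pi} ?h"
    by (intro continuous_intros)
  have "v 0 \<le> circle_mean v 0 r"
    using sub r U unfolding subharmonic_on_def by blast
  also have "\<dots> \<le> ereal (integral {0..2*pi} ?h / (2*pi))"
  proof (rule circle_mean_le[OF _ cont])
    fix t
    have "norm (of_real r * cis t) = r" using r by (simp add: norm_mult)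
    then show "v (0 + of_real r * cis t) \<le> ereal (?h t)"
      using le[of "of_real r * cis t"] \<open>0 < R\<close> by (simp add: r_def)
  qed
  also have "\<dots> = ereal (Re (G 0) - k * r\<^sup>2)"
    unfolding I by (simp add: field_simps)
  finally have "k * r\<^sup>2 \<le> 0"
    using eq by simp
  then show False
    using \<open>0 < k\<close> r(1) by (simp add: mult_le_0_iff)
qed

section \<open>Upper semicontinuous functions\<close>

lemma usc_on_attains_max:
  assumes K: "compact K" "K \<noteq> {}" and usc: "usc_on K f"
  shows "\<exists>x\<in>K. \<forall>y\<in>K. f y \<le> f x"
proof (rule ccontr)
  assume "\<not> ?thesis"
  then have above: "\<forall>x\<in>K. \<exists>y\<in>K. f x < f y"
    by (auto simp: not_le)
  have "\<forall>y. \<exists>T. open T \<and> {x\<in>K. f x < f y} = K \<inter> T"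
    using usc by (simp add: usc_on_def openin_open)
  from choice[OF this] obtain T where T: "\<And>y. open (T y)" "\<And>y. {x\<in>K. f x < f y} = K \<inter> T y"
    by auto
  have "K \<subseteq> (\<Union>y\<in>K. T y)"
    using above T(2) by blast
  then obtain D where D: "D \<subseteq> K" "finite D" "K \<subseteq> (\<Union>y\<in>D. T y)"
    using compactE_image[OF K(1), of K T] T(1) by auto
  then have "D \<noteq> {}" using K(2) by auto
  then have "Max (f ` D) \<in> f ` D"
    using D(2) by (intro Max_in) auto
  then obtain y where y: "y \<in> D" "f y = Max (f ` D)"
    by auto
  then obtain z where "z \<in> D" "y \<in> T z"
    using D by blast
  then have "f y < f z" using y D T(2)[of z] by blast
  then show False
    using y \<open>z \<in> D\<close> D(2) by (metis Max_ge finite_imageI imageI leD)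
qed

lemma usc_on_compose:
  assumes "usc_on T u" and "continuous_on S h" and "h ` S \<subseteq> T"
  shows "usc_on S (\<lambda>x. u (h x))"
  unfolding usc_on_def
proof
  fix c
  have "openin (top_of_set S) (S \<inter> h -` {x\<in>T. u x < c})"
    using assms by (intro continuous_openin_preimage[of S h T]) (auto simp: usc_on_def)
  moreover have "S \<inter> h -` {x\<in>T. u x < c} = {x\<in>S. u (h x) < c}"
    using assms(3) by auto
  ultimately show "openin (top_of_set S) {x\<in>S. u (h x) < c}" by simp
qed

lemma usc_on_add_continuous:
  assumes u: "usc_on S u" and g: "continuous_on S g"
  shows "usc_on S (\<lambda>x. u x + ereal (g x))"
  unfolding usc_on_def
proof
  fix c :: ereal
  have "{x\<in>S. u x + ereal (g x) < c}
      = (\<Union>q. {x\<in>S. u x < ereal q} \<inter> {x\<in>S. ereal (q + g x) < c})" (is "?L = ?R")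
  proof
    show "?L \<subseteq> ?R"
    proof
      fix x assume x: "x \<in> ?L"
      then have "u x < c - ereal (g x)"
        by (cases "u x"; cases c) auto
      then obtain q where "u x < ereal q" "ereal q < c - ereal (g x)"
        using ereal_dense2 by blast
      then have "ereal (q + g x) < c"
        by (cases c) auto
      with \<open>u x < ereal q\<close> x show "x \<in> ?R" by blast
    qed
    show "?R \<subseteq> ?L"
    proof
      fix x assume "x \<in> ?R"
      then obtain q where q: "x \<in> S" "u x < ereal q" "ereal (q + g x) < c" by auto
      then have "u x + ereal (g x) \<le> ereal (q + g x)"
        by (cases "u x") auto
      then show "x \<in> ?L" using q by auto
    qed
  qed
  moreover have "openin (top_of_set S) ({x\<in>S. u x < ereal q} \<inter> {x\<in>S. ereal (q + g x) < c})" for q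
  proof (rule openin_Int)
    show "openin (top_of_set S) {x\<in>S. u x < ereal q}"
      using u by (simp add: usc_on_def)
    have "continuous_on S (\<lambda>x. ereal (q + g x))"
      by (intro continuous_intros g)
    then have "openin (top_of_set S) (S \<inter> (\<lambda>x. ereal (q + g x)) -` {..<c})"
      by (rule continuous_openin_preimage_gen) auto
    moreover have "S \<inter> (\<lambda>x. ereal (q + g x)) -` {..<c} = {x\<in>S. ereal (q + g x) < c}"
      by auto
    ultimately show "openin (top_of_set S) {x\<in>S. ereal (q + g x) < c}" by simp
  qed
  ultimately show "openin (top_of_set S) ?L" by auto
qed

section \<open>Plurisubharmonic functions along holomorphic discs\<close>

text \<open>
Plurisubharmonicity is a condition on complex lines only; this lemma is what makes it act along the
curved disc \<open>F\<close>.  The test function carries the penalty \<open>N * (norm z)\<^sup>2\<close>, where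
\<open>z = x - F t\<close> is the deviation of a point \<open>x\<close> from the disc.  On the line through the
touching point in the direction \<open>D\<close> of the derivative of \<open>F\<close> at \<open>p\<close>, the deviation is
\<open>y - q t\<close> with \<open>q\<close> holomorphic and \<open>q t = o(norm t)\<close>.  Expanding the square, the mixed term
is the real part of a holomorphic function and the remaining term is \<open>o((norm t)\<^sup>2)\<close>,
so for every \<open>N\<close> the penalty is absorbed by \<open>k * (norm t)\<^sup>2\<close>.
\<close>

lemma plurisubharmonic_no_touching:
  fixes u :: "complex^'n \<Rightarrow> ereal" and F :: "complex \<Rightarrow> complex^'n"
  assumes psh: "plurisubharmonic_on \<Omega> u" and "0 < R" "0 < k" "0 \<le> N"
    and F: "\<And>i. (\<lambda>t. F t $ i) holomorphic_on ball p R"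
    and h: "h holomorphic_on ball p R"
    and in\<Omega>: "\<And>t z. t \<in> ball p R \<Longrightarrow> z \<in> ball y R \<Longrightarrow> F t + z \<in> \<Omega>"
    and c: "u (F p + y) = ereal c"
    and touch: "\<And>t z. t \<in> ball p R \<Longrightarrow> z \<in> ball y R \<Longrightarrow> u (F t + z) \<le>
      ereal (c + Re (h t - h p) - k * ((norm t)\<^sup>2 - (norm p)\<^sup>2) + N * ((norm z)\<^sup>2 - (norm y)\<^sup>2))"
  shows False
proof -
  define D where "D = (\<chi> i. deriv (\<lambda>t. F t $ i) p)"
  define q where "q = (\<lambda>t. F (p + t) - F p - t *s D)"
  \<comment> \<open>chosen such that \<open>N * (norm (q t))\<^sup>2 \<le> k / 2 * (norm t)\<^sup>2\<close> whenever \<open>norm (q t) \<le> s * norm t\<close>\<close>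
  define s where "s = sqrt (k / (2 * (N + 1)))"
  have s: "0 < s" "N * s\<^sup>2 \<le> k / 2"
    using \<open>0 < k\<close> \<open>0 \<le> N\<close> by (auto simp: s_def field_simps)
  have "\<forall>\<^sub>F t in nhds 0. norm (q t $ i) \<le> s / CARD('n) * norm t" for i
  proof -
    have "((\<lambda>t. F t $ i) has_field_derivative D $ i) (at p)"
      using F[of i] \<open>0 < R\<close> by (auto simp: D_def intro!: holomorphic_derivI[of _ "ball p R"])
    then have "((\<lambda>t. F t $ i) has_derivative (*) (D $ i)) (at p)"
      by (simp add: has_field_derivative_def)
    moreover have "0 < s / CARD('n)" using s by simp
    ultimately obtain d where d: "d > 0"
      "\<And>t. norm (t - p) < d \<Longrightarrow> norm (F t $ i - F p $ i - D $ i * (t - p)) \<le> s / CARD('n) * norm (t - p)"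
      unfolding has_derivative_at_alt by meson
    have "norm (q t $ i) \<le> s / CARD('n) * norm t" if "norm t < d" for t
      using d(2)[of "p + t"] that by (simp add: q_def algebra_simps)
    then show ?thesis
      using d(1) by (auto simp: eventually_nhds_metric intro!: exI[of _ d])
  qed
  then have "\<forall>\<^sub>F t in nhds 0. \<forall>i. norm (q t $ i) \<le> s / CARD('n) * norm t"
    by (rule eventually_all_finite)
  then obtain d where d: "d > 0" "\<And>t i. norm t < d \<Longrightarrow> norm (q t $ i) \<le> s / CARD('n) * norm t"
    by (auto simp: eventually_nhds_metric)
  have q: "norm (q t) \<le> s * norm t" if "norm t < d" for t
  proof -
    have "norm (q t) \<le> (\<Sum>i\<in>UNIV. norm (q t $ i))"
      by (simp add: norm_vec_def L2_set_le_sum)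
    also have "\<dots> \<le> (\<Sum>i\<in>(UNIV::'n set). s / CARD('n) * norm t)"
      by (intro sum_mono d(2) that)
    finally show ?thesis by simp
  qed
  define r where "r = min (min d R) (R / s)"
  have r: "0 < r" "r \<le> d" "r \<le> R" "r \<le> R / s"
    using d \<open>0 < R\<close> s by (auto simp: r_def)
  have line: "F p + y + t *s D = F (p + t) + (y - q t)" for t
    by (simp add: q_def algebra_simps)
  have near: "p + t \<in> ball p R" "y - q t \<in> ball y R" if "t \<in> ball 0 r" for t
  proof -
    have t: "norm t < r" using that by simp
    then show "p + t \<in> ball p R" using r by (simp add: dist_norm)
    have "norm (q t) \<le> s * norm t" using q t r by simp
    also have "\<dots> < s * r" using s t by simp
    also have "\<dots> \<le> R" using r s by (simp add: field_simps)
    finally show "y - q t \<in> ball y R" by (simp add: dist_norm)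
  qed
  define G where "G = (\<lambda>t. of_real c + (h (p + t) - h p) - 2 * of_real k * (cnj p * t)
    - 2 * of_real N * (\<Sum>i\<in>UNIV. cnj (y $ i) * q t $ i))"
  have sub: "subharmonic_on {t. F p + y + t *s D \<in> \<Omega>} (\<lambda>t. u (F p + y + t *s D))"
    using psh by (simp add: plurisubharmonic_on_def)
  show False
  proof (rule subharmonic_no_strict_touching[OF sub, of r "k / 2" G])
    show "ball 0 r \<subseteq> {t. F p + y + t *s D \<in> \<Omega>}"
      using in\<Omega> near by (auto simp: line)
    show "0 < r" "0 < k / 2" using r \<open>0 < k\<close> by auto
    have shift: "(\<lambda>t. f (p + t)) holomorphic_on ball 0 r" if "f holomorphic_on ball p R" for f
    proof -
      have "f \<circ> (\<lambda>t. p + t) holomorphic_on ball 0 r"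
        using r(3) by (intro holomorphic_on_compose_gen[OF _ that] holomorphic_intros) auto
      then show ?thesis by (simp add: o_def)
    qed
    show "G holomorphic_on ball 0 r"
      unfolding G_def q_def
      by (auto intro!: holomorphic_intros shift F h)
    have "q 0 = 0" by (simp add: q_def)
    then show "u (F p + y + 0 *s D) = ereal (Re (G 0))"
      by (simp add: G_def c)
    fix t :: complex assume t: "t \<in> ball 0 r"
    have ip: "Re (\<Sum>i\<in>UNIV. cnj (y $ i) * q t $ i) = y \<bullet> q t"
      by (simp add: inner_vec_def inner_complex_def)
    have np: "(norm (p + t))\<^sup>2 - (norm p)\<^sup>2 = 2 * Re (cnj p * t) + (norm t)\<^sup>2"
      unfolding cmod_power2 by (simp add: power2_eq_square algebra_simps)
    have ny: "(norm (y - q t))\<^sup>2 - (norm y)\<^sup>2 = (norm (q t))\<^sup>2 - 2 * (y \<bullet> q t)"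
      by (simp add: power2_norm_eq_inner inner_diff inner_commute)
    have "(norm (q t))\<^sup>2 \<le> (s * norm t)\<^sup>2"
      using q t r by (intro power_mono) auto
    then have "N * (norm (q t))\<^sup>2 \<le> N * s\<^sup>2 * (norm t)\<^sup>2"
      using \<open>0 \<le> N\<close> by (simp add: power_mult_distrib mult_left_mono mult.assoc)
    also have "\<dots> \<le> k / 2 * (norm t)\<^sup>2"
      using s by (intro mult_right_mono) auto
    finally have small: "N * (norm (q t))\<^sup>2 \<le> k / 2 * (norm t)\<^sup>2" .
    have "u (F p + y + t *s D) \<le>
      ereal (c + Re (h (p + t) - h p) - k * (2 * Re (cnj p * t) + (norm t)\<^sup>2)
        + N * ((norm (q t))\<^sup>2 - 2 * (y \<bullet> q t)))"
      using touch[OF near[OF t]] by (simp only: line np ny)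
    also have "\<dots> \<le> ereal (Re (G t) - k / 2 * (norm t)\<^sup>2)"
    proof -
      have "Re (G t) = c + Re (h (p + t) - h p) - 2 * k * Re (cnj p * t) - 2 * N * (y \<bullet> q t)"
        unfolding G_def ip[symmetric] by simp
      with small show ?thesis by (simp add: algebra_simps)
    qed
    finally show "u (F p + y + t *s D) \<le> ereal (Re (G t) - k / 2 * (norm t)\<^sup>2)" .
  qed
qed

text \<open>
A maximum principle for \<open>u\<close> on the disc against the harmonic function
\<open>C + \<mu> * ln (norm t)\<close>.  A point violating it makes the maximum over
\<open>(t, z)\<close> of \<open>u (F t + z) - (C + \<mu> * ln (norm t)) + \<eta> * (norm t)\<^sup>2 - N * (norm z)\<^sup>2\<close>
exceed \<open>2 * \<eta>\<close>.  For large \<open>N\<close> the maximum is attained away from the boundary of the parameter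
range, contrary to \<open>plurisubharmonic_no_touching\<close>.  Penalising the deviation \<open>z\<close>, instead of
restricting \<open>u\<close> to the disc, keeps a full neighbourhood available, and with it the complex line
tangent to the disc.
\<close>

lemma plurisubharmonic_annulus_bound:
  fixes u :: "complex^'n \<Rightarrow> ereal" and F :: "complex \<Rightarrow> complex^'n"
  assumes \<Omega>: "open \<Omega>" and psh: "plurisubharmonic_on \<Omega> u"
    and neg: "\<And>z. z \<in> \<Omega> \<Longrightarrow> u z \<le> 0"
    and F: "\<And>i. (\<lambda>t. F t $ i) holomorphic_on ball 0 1" and F\<Omega>: "F ` ball 0 1 \<subseteq> \<Omega>"
    and r: "0 < r" "r < R" "R < 1" and "0 < \<eta>"
    and circle: "\<And>t. norm t = r \<or> norm t = R \<Longrightarrow> u (F t) \<le> ereal (C + \<mu> * ln (norm t) + \<eta>)"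
    and T: "r < norm T" "norm T < R"
  shows "u (F T) \<le> ereal (C + \<mu> * ln (norm T) + 2 * \<eta>)"
proof (rule ccontr)
  assume contra: "\<not> ?thesis"
  define K where "K = {t :: complex. r \<le> norm t \<and> norm t \<le> R}"
  have K_alt: "K = cball 0 R - ball 0 r"
    by (auto simp: K_def)
  have K: "compact K" unfolding K_alt by (rule compact_diff) auto
  have K_ball: "K \<subseteq> ball 0 1" and K0: "0 \<notin> K" using r by (auto simp: K_def)
  have TK: "T \<in> K" using T by (auto simp: K_def)
  have "continuous_on (ball 0 1) (\<lambda>t. \<chi> i. F t $ i)"
    by (intro continuous_on_vec_lambda holomorphic_on_imp_continuous_on F)
  then have "continuous_on (ball 0 1) F" by (simp add: vec_lambda_eta)
  then have FK: "continuous_on K F" using K_ball by (rule continuous_on_subset)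
  obtain e where e: "0 < e" "\<And>t z. t \<in> K \<Longrightarrow> norm z \<le> e \<Longrightarrow> F t + z \<in> \<Omega>"
  proof -
    have "compact (F ` K)" "F ` K \<subseteq> \<Omega>"
      using compact_continuous_image[OF FK K] F\<Omega> K_ball by auto
    then obtain e where "0 < e" "(\<Union>x\<in>F ` K. cball x e) \<subseteq> \<Omega>"
      using compact_subset_open_imp_cball_epsilon_subset[OF _ \<Omega>] by blast
    moreover have "F t + z \<in> cball (F t) e" if "norm z \<le> e" for t z
      using that by (simp add: dist_norm)
    ultimately show thesis
      by (intro that[of e]) blast+
  qed
  define g where "g = (\<lambda>t::complex. \<eta> * (norm t)\<^sup>2 - (C + \<mu> * ln (norm t)))"
  define M where "M = K \<times> cball (0::complex^'n) e"
  have M: "compact M" unfolding M_def by (intro compact_Times K) auto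
  have g_cont: "continuous_on M (\<lambda>x. g (fst x))"
    unfolding g_def using K0 by (intro continuous_intros) (auto simp: M_def)
  have FM: "continuous_on M (\<lambda>x. F (fst x) + snd x)"
    by (intro continuous_intros continuous_on_compose2[OF FK]) (auto simp: M_def)
  have "usc_on M (\<lambda>x. u (F (fst x) + snd x))"
    using psh e(2) by (intro usc_on_compose[OF _ FM]) (auto simp: plurisubharmonic_on_def M_def)
  then have usc: "usc_on M (\<lambda>x. u (F (fst x) + snd x) + ereal (g (fst x)))"
    using g_cont by (rule usc_on_add_continuous)
  define \<Phi> where "\<Phi> = (\<lambda>x. u (F (fst x) + snd x) + ereal (g (fst x)))"
  define E where "E = {x\<in>M. norm (fst x) = r \<or> norm (fst x) = R \<or> norm (snd x) = e}"
  \<comment> \<open>the boundary points at which the unpenalised function is still large; upper semicontinuity keeps them away from \<open>z = 0\<close>\<close>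
  define B where "B = {x\<in>E. ereal (2 * \<eta>) \<le> \<Phi> x}"
  have "compact B"
  proof -
    have "closed {x :: complex \<times> (complex^'n). norm (fst x) = r \<or> norm (fst x) = R \<or> norm (snd x) = e}"
      by (intro closed_Collect_disj closed_Collect_eq continuous_intros)
    moreover have "closedin (top_of_set M) (M - {x\<in>M. \<Phi> x < ereal (2 * \<eta>)})"
      using usc unfolding usc_on_def \<Phi>_def by (intro closedin_diff) auto
    then have "compact (M - {x\<in>M. \<Phi> x < ereal (2 * \<eta>)})"
      using M closedin_compact by blast
    moreover have "B = (M - {x\<in>M. \<Phi> x < ereal (2 * \<eta>)}) \<inter>
        {x. norm (fst x) = r \<or> norm (fst x) = R \<or> norm (snd x) = e}"
      by (auto simp: B_def E_def not_less)
    ultimately show ?thesis by (simp add: compact_Int_closed)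
  qed
  have B0: "snd x \<noteq> 0" if "x \<in> B" for x
  proof
    assume z: "snd x = 0"
    obtain t where x: "x = (t, 0)" using z by (cases x) auto
    have t: "norm t = r \<or> norm t = R" and "norm t < 1"
      using that e(1) r by (auto simp: B_def E_def x)
    then have "\<eta> * (norm t)\<^sup>2 < \<eta> * 1"
      using \<open>0 < \<eta>\<close> by (intro mult_strict_left_mono power_less_one_iff[THEN iffD2]) auto
    then have "ereal (C + \<mu> * ln (norm t) + \<eta>) + ereal (g t) < ereal (2 * \<eta>)"
      by (simp add: g_def)
    moreover have "ereal (2 * \<eta>) \<le> u (F t) + ereal (g t)"
      using that by (simp add: B_def \<Phi>_def x)
    ultimately show False
      using circle[OF t] add_right_mono[of "u (F t)" _ "ereal (g t)"] by (meson leD order_trans)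
  qed
  obtain \<delta> where \<delta>: "0 < \<delta>" "\<And>x. x \<in> B \<Longrightarrow> \<delta> \<le> norm (snd x)"
  proof (cases "B = {}")
    case True
    then show thesis by (intro that[of 1]) auto
  next
    case False
    have "continuous_on B (\<lambda>x. norm (snd x))" by (intro continuous_intros)
    then obtain x where "x \<in> B" "\<forall>y\<in>B. norm (snd x) \<le> norm (snd y)"
      using continuous_attains_inf[OF \<open>compact B\<close> False] by blast
    then show thesis using B0 by (intro that[of "norm (snd x)"]) auto
  qed
  obtain b where b: "\<And>x. x \<in> M \<Longrightarrow> g (fst x) \<le> b"
  proof -
    have "M \<noteq> {}" using TK e(1) by (auto simp: M_def)
    then show thesis
      using continuous_attains_sup[OF M _ g_cont] that by blast
  qed
  \<comment> \<open>\<open>u \<le> 0\<close> and \<open>g \<le> b\<close>, so this \<open>N\<close> makes the penalised function negative on \<open>B\<close>\<close>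
  define N where "N = (\<bar>b\<bar> + 1) / \<delta>\<^sup>2"
  have N: "0 < N" "N * \<delta>\<^sup>2 = \<bar>b\<bar> + 1" using \<delta>(1) by (auto simp: N_def)
  have "continuous_on M (\<lambda>x. g (fst x) - N * (norm (snd x))\<^sup>2)"
    by (intro continuous_intros g_cont)
  then have "usc_on M (\<lambda>x. u (F (fst x) + snd x) + ereal (g (fst x) - N * (norm (snd x))\<^sup>2))"
    using \<open>usc_on M (\<lambda>x. u (F (fst x) + snd x))\<close> by (intro usc_on_add_continuous)
  moreover have "M \<noteq> {}" using TK e(1) by (auto simp: M_def)
  ultimately obtain x where x: "x \<in> M" and xmax: "\<And>z. z \<in> M \<Longrightarrow>
      u (F (fst z) + snd z) + ereal (g (fst z) - N * (norm (snd z))\<^sup>2)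
      \<le> u (F (fst x) + snd x) + ereal (g (fst x) - N * (norm (snd x))\<^sup>2)"
    using usc_on_attains_max[OF M] by blast
  obtain p y where py: "x = (p, y)" by (cases x)
  have pK: "p \<in> K" and ye: "norm y \<le> e" using x by (auto simp: M_def py)
  have "u (F p + y) \<le> 0" using neg e(2) pK ye by blast
  have "ereal (2 * \<eta>) < u (F T) + ereal (g T)"
  proof -
    have "0 < \<eta> * (norm T)\<^sup>2" using \<open>0 < \<eta>\<close> T r by (intro mult_pos_pos) auto
    then show ?thesis using contra by (cases "u (F T)") (auto simp: g_def)
  qed
  also have "\<dots> \<le> u (F p + y) + ereal (g p - N * (norm y)\<^sup>2)"
    using xmax[of "(T, 0)"] TK e(1) by (simp add: M_def py)
  finally have big: "ereal (2 * \<eta>) < u (F p + y) + ereal (g p - N * (norm y)\<^sup>2)" .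
  then obtain c where c: "u (F p + y) = ereal c"
    using \<open>u (F p + y) \<le> 0\<close> by (cases "u (F p + y)") auto
  with big \<open>u (F p + y) \<le> 0\<close> have "c \<le> 0" and cbig: "2 * \<eta> < c + (g p - N * (norm y)\<^sup>2)" by auto
  have "x \<notin> B"
  proof
    assume "x \<in> B"
    then have "\<delta>\<^sup>2 \<le> (norm y)\<^sup>2" using \<delta> by (intro power_mono) (auto simp: py)
    then have "N * \<delta>\<^sup>2 \<le> N * (norm y)\<^sup>2" using N(1) by simp
    then show False using N b[OF x] cbig \<open>c \<le> 0\<close> \<open>0 < \<eta>\<close> by (simp add: py)
  qed
  moreover have "ereal (2 * \<eta>) \<le> \<Phi> x"
  proof -
    have "0 \<le> N * (norm y)\<^sup>2" using N by simp
    then show ?thesis using cbig by (simp add: \<Phi>_def py c)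
  qed
  ultimately have "x \<notin> E" by (simp add: B_def)
  then have p: "r < norm p" "norm p < R" and y: "norm y < e"
    using x by (auto simp: E_def M_def K_def py)
  define R' where "R' = Min {norm p - r, R - norm p, e - norm y, norm p}"
  have R': "0 < R'" "R' \<le> norm p - r" "R' \<le> R - norm p" "R' \<le> e - norm y" "R' \<le> norm p"
    using p y r by (auto simp: R'_def)
  have tp: "t \<in> K" "0 < Re (t / p)" if "t \<in> ball p R'" for t
  proof -
    have d: "norm (t - p) < R'" using that by (simp add: dist_norm norm_minus_commute)
    then show "t \<in> K"
      using norm_triangle_ineq2[of t p] norm_triangle_ineq2[of p t] R'
      by (auto simp: K_def norm_minus_commute)
    have "p \<noteq> 0" using p r by auto
    then have "norm (t / p - 1) = norm (t - p) / norm p"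
      by (simp add: norm_divide [symmetric] diff_divide_distrib)
    also have "\<dots> < 1" using d R' \<open>p \<noteq> 0\<close> by simp
    finally have "\<bar>Re (t / p - 1)\<bar> < 1" using abs_Re_le_cmod le_less_trans by blast
    then show "0 < Re (t / p)" by simp
  qed
  have ze: "norm z \<le> e" if "z \<in> ball y R'" for z
    using that R' norm_triangle_ineq2[of z y] by (simp add: dist_norm norm_minus_commute)
  \<comment> \<open>a holomorphic function with real part \<open>\<mu> * (ln (norm t) - ln (norm p))\<close>; dividing by \<open>p\<close> keeps \<open>Ln\<close> off its branch cut\<close>
  define h where "h = (\<lambda>t. of_real \<mu> * Ln (t / p))"
  show False
  proof (rule plurisubharmonic_no_touching[OF psh R'(1) \<open>0 < \<eta>\<close>, of N F p h y c])
    show "0 \<le> N" using N by simp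
    show "(\<lambda>t. F t $ i) holomorphic_on ball p R'" for i
      using tp(1) K_ball by (intro holomorphic_on_subset[OF F]) auto
    have "t / p \<notin> \<real>\<^sub>\<le>\<^sub>0" if "t \<in> ball p R'" for t
      using tp(2)[OF that] by (simp add: complex_nonpos_Reals_iff)
    moreover have "p \<noteq> 0" using p r by auto
    ultimately show "h holomorphic_on ball p R'"
      unfolding h_def by (intro holomorphic_intros) simp_all
    show "F t + z \<in> \<Omega>" if "t \<in> ball p R'" "z \<in> ball y R'" for t z
      using that tp ze e(2) by blast
    show "u (F p + y) = ereal c" by fact
    fix t z assume t: "t \<in> ball p R'" and z: "z \<in> ball y R'"
    have "p \<noteq> 0" "t \<noteq> 0" using p r tp(1)[OF t] K0 by auto
    then have hh: "Re (h t - h p) = \<mu> * (ln (norm t) - ln (norm p))"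
      by (simp add: h_def norm_divide ln_div)
    have "u (F t + z) + ereal (g t - N * (norm z)\<^sup>2) \<le> ereal (c + (g p - N * (norm y)\<^sup>2))"
      using xmax[of "(t, z)"] tp(1)[OF t] ze[OF z] by (simp add: M_def py c)
    then have "u (F t + z) \<le> ereal (c + (g p - N * (norm y)\<^sup>2) - (g t - N * (norm z)\<^sup>2))"
      by (cases "u (F t + z)") auto
    then show "u (F t + z) \<le> ereal (c + Re (h t - h p)
        - \<eta> * ((norm t)\<^sup>2 - (norm p)\<^sup>2) + N * ((norm z)\<^sup>2 - (norm y)\<^sup>2))"
      unfolding hh by (simp add: g_def algebra_simps)
  qed
qed

text \<open>
Apply the annulus bound with a slope \<open>\<mu>\<close> slightly smaller than \<open>\<nu>\<close>: then
\<open>C + \<mu> * ln (norm t)\<close> dominates \<open>u (F t)\<close> close to the pole as well as close to the unit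
circle, and \<open>\<mu>\<close> may tend to \<open>\<nu>\<close>.
\<close>

lemma plurisubharmonic_disc_log_bound:
  fixes u :: "complex^'n \<Rightarrow> ereal" and F :: "complex \<Rightarrow> complex^'n"
  assumes \<Omega>: "open \<Omega>" and psh: "plurisubharmonic_on \<Omega> u"
    and neg: "\<And>z. z \<in> \<Omega> \<Longrightarrow> u z \<le> 0"
    and F: "\<And>i. (\<lambda>t. F t $ i) holomorphic_on ball 0 1" and F\<Omega>: "F ` ball 0 1 \<subseteq> \<Omega>"
    and bound: "\<And>t. t \<in> ball 0 1 - {0} \<Longrightarrow> u (F t) \<le> ereal C"
    and pole: "\<forall>\<^sub>F t in at 0. u (F t) \<le> ereal (\<nu> * ln (norm t) + C')"
    and "0 < \<nu>" and T: "T \<in> ball 0 1 - {0}"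
  shows "u (F T) \<le> ereal (C + \<nu> * ln (norm T))"
proof (rule ccontr)
  assume contra: "\<not> ?thesis"
  define L where "L = - ln (norm T)"
  have L: "0 < L" using T by (simp add: L_def)
  obtain U where U: "u (F T) = ereal U" "C - \<nu> * L < U"
    using contra bound[OF T] by (cases "u (F T)") (auto simp: L_def)
  define d where "d = U - (C - \<nu> * L)"
  have "0 < d" using U by (simp add: d_def)
  \<comment> \<open>the loss in slope, small enough to cost at most \<open>d / 4\<close> at \<open>T\<close>\<close>
  define s where "s = min (\<nu> / 2) (d / (4 * L))"
  have s: "0 < s" "s < \<nu>" "s * L \<le> d / 4"
    using L \<open>0 < d\<close> \<open>0 < \<nu>\<close> by (auto simp: s_def min_def field_simps)
  define \<mu> where "\<mu> = \<nu> - s"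
  have \<mu>: "0 < \<mu>" using s by (simp add: \<mu>_def)
  obtain r0 where r0: "0 < r0" "\<And>t. t \<noteq> 0 \<Longrightarrow> norm t < r0 \<Longrightarrow> u (F t) \<le> ereal (\<nu> * ln (norm t) + C')"
    using pole by (auto simp: eventually_at)
  define r where "r = min (min (r0 / 2) (norm T / 2)) (exp ((C + d / 4 - C') / s))"
  define R where "R = max (exp (- (d / 4) / \<mu>)) ((1 + norm T) / 2)"
  have r: "0 < r" "r < r0" "r < norm T" "ln r \<le> (C + d / 4 - C') / s"
  proof -
    have "r \<le> r0 / 2" "r \<le> norm T / 2" "r \<le> exp ((C + d / 4 - C') / s)"
      unfolding r_def by simp_all
    moreover show "0 < r" using r0 T by (simp add: r_def)
    ultimately show "r < r0" "r < norm T" using r0(1) T by simp_all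
    have "ln r \<le> ln (exp ((C + d / 4 - C') / s))"
      using \<open>0 < r\<close> \<open>r \<le> exp ((C + d / 4 - C') / s)\<close> by (subst ln_le_cancel_iff) simp_all
    then show "ln r \<le> (C + d / 4 - C') / s" by simp
  qed
  have R: "norm T < R" "R < 1" "- (d / 4) / \<mu> \<le> ln R"
  proof -
    show "R < 1" using T \<open>0 < d\<close> \<mu> by (auto simp: R_def)
    have "norm T < (1 + norm T) / 2" using T by simp
    also have "\<dots> \<le> R" by (simp add: R_def)
    finally show "norm T < R" .
    show "- (d / 4) / \<mu> \<le> ln R"
      by (subst ln_ge_iff) (auto simp: R_def less_max_iff_disj)
  qed
  have "u (F T) \<le> ereal (C + \<mu> * ln (norm T) + 2 * (d / 4))"
  proof (rule plurisubharmonic_annulus_bound[OF \<Omega> psh neg F F\<Omega>, of r R])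
    show "0 < r" "r < R" "R < 1" "0 < d / 4" "r < norm T" "norm T < R"
      using r R \<open>0 < d\<close> by auto
    fix t :: complex assume "norm t = r \<or> norm t = R"
    then show "u (F t) \<le> ereal (C + \<mu> * ln (norm t) + d / 4)"
    proof
      assume t: "norm t = r"
      have "s * ln r \<le> C + d / 4 - C'" using r(4) s by (simp add: field_simps)
      then have "\<nu> * ln r + C' \<le> C + \<mu> * ln r + d / 4"
        by (simp add: \<mu>_def algebra_simps)
      moreover have "u (F t) \<le> ereal (\<nu> * ln r + C')"
        using r0(2)[of t] r t by auto
      ultimately show ?thesis
        unfolding t by (meson ereal_less_eq(3) order_trans)
    next
      assume t: "norm t = R"
      moreover have "t \<noteq> 0" using t R r by auto
      ultimately have "u (F t) \<le> ereal C" using bound[of t] R by simp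
      moreover have "C \<le> C + \<mu> * ln R + d / 4" using R(3) \<mu> by (simp add: field_simps)
      ultimately show ?thesis
        unfolding t by (meson ereal_less_eq(3) order_trans)
    qed
  qed
  then have "U \<le> C - \<mu> * L + d / 2" using U by (simp add: L_def)
  moreover have "\<mu> * L = \<nu> * L - s * L" by (simp add: \<mu>_def algebra_simps)
  ultimately show False using s(3) \<open>0 < d\<close> unfolding d_def by argo
qed

text \<open>
Since \<open>F\<close> is differentiable, \<open>norm (F t - F 0)\<close> is at most a multiple of \<open>norm t\<close>, so a
pole of weight \<open>\<nu>\<close> at \<open>F 0\<close> becomes one of at least this weight at \<open>t = 0\<close>.
\<close>

lemma green_family_disc_bound:
  fixes u :: "complex^'n \<Rightarrow> ereal" and F :: "complex \<Rightarrow> complex^'n"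
  assumes \<Omega>: "open \<Omega>" and u: "u \<in> green_family \<Omega> A" and A: "(F 0, \<nu>) \<in> A" and "0 < \<nu>"
    and F: "\<And>i. (\<lambda>t. F t $ i) holomorphic_on ball 0 1" and F\<Omega>: "F ` ball 0 1 \<subseteq> \<Omega>"
    and inj: "\<And>t. t \<in> ball 0 1 - {0} \<Longrightarrow> F t \<noteq> F 0"
    and bound: "\<And>t. t \<in> ball 0 1 - {0} \<Longrightarrow> u (F t) \<le> ereal C"
    and T: "T \<in> ball 0 1 - {0}"
  shows "u (F T) \<le> ereal (C + \<nu> * ln (norm T))"
proof -
  have psh: "plurisubharmonic_on \<Omega> u" and neg: "\<And>z. z \<in> \<Omega> \<Longrightarrow> u z \<le> 0"
    using u by (auto simp: green_family_def)
  obtain C' where C': "\<forall>\<^sub>F z in at (F 0). u z - ereal (\<nu> * ln (norm (z - F 0))) \<le> ereal C'"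
    using u A by (force simp: green_family_def)
  have F_cont: "isCont F 0"
  proof -
    have "isCont (\<lambda>t. F t $ i) 0" for i
      using holomorphic_on_imp_continuous_on[OF F] by (auto simp: continuous_on_eq_continuous_at)
    then show ?thesis
      by (simp add: isCont_def vec_tendstoI)
  qed
  have "filterlim F (at (F 0)) (at 0)"
    unfolding filterlim_at
  proof
    show "\<forall>\<^sub>F t in at 0. F t \<in> UNIV \<and> F t \<noteq> F 0"
      using inj by (auto simp: eventually_at intro!: exI[of _ 1])
    show "(F \<longlongrightarrow> F 0) (at 0)" using F_cont by (simp add: isCont_def)
  qed
  then have ev: "\<forall>\<^sub>F t in at 0. u (F t) - ereal (\<nu> * ln (norm (F t - F 0))) \<le> ereal C'"
    using C' by (rule filterlim_iff[THEN iffD1, rule_format])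
  obtain B where B: "0 < B" "\<forall>\<^sub>F t in at 0. norm (F t - F 0) \<le> B * norm t"
  proof -
    define b where "b = (\<lambda>i. norm (deriv (\<lambda>t. F t $ i) 0) + 1)"
    have "\<forall>\<^sub>F t in at 0. norm ((F t - F 0) $ i) \<le> b i * norm t" for i
    proof -
      have "((\<lambda>t. F t $ i) has_field_derivative deriv (\<lambda>t. F t $ i) 0) (at 0)"
        using F[of i] by (auto intro!: holomorphic_derivI[of _ "ball 0 1"])
      then have "((\<lambda>t. norm ((F t $ i - F 0 $ i) / t)) \<longlongrightarrow> norm (deriv (\<lambda>t. F t $ i) 0)) (at 0)"
        by (intro tendsto_norm) (simp add: DERIV_def)
      then have "\<forall>\<^sub>F t in at 0. norm ((F t $ i - F 0 $ i) / t) < b i"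
        by (rule order_tendstoD(2)) (simp add: b_def)
      then show ?thesis
        by (rule eventually_mp[rotated]) (auto simp: eventually_at norm_divide field_simps
            intro!: exI[of _ 1])
    qed
    then have "\<forall>\<^sub>F t in at 0. \<forall>i. norm ((F t - F 0) $ i) \<le> b i * norm t"
      by (rule eventually_all_finite)
    then have "\<forall>\<^sub>F t in at 0. norm (F t - F 0) \<le> (\<Sum>i\<in>UNIV. b i) * norm t"
    proof eventually_elim
      case (elim t)
      have "norm (F t - F 0) \<le> (\<Sum>i\<in>UNIV. norm ((F t - F 0) $ i))"
        by (simp add: norm_vec_def L2_set_le_sum)
      also have "\<dots> \<le> (\<Sum>i\<in>UNIV. b i * norm t)"
        using elim by (intro sum_mono) auto
      finally show ?case by (simp add: sum_distrib_right)
    qed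
    moreover have "0 < (\<Sum>i\<in>UNIV. b i)"
      by (rule sum_pos) (auto simp: b_def intro: add_nonneg_pos)
    ultimately show thesis using that by blast
  qed
  have "\<forall>\<^sub>F t in at 0. t \<in> ball 0 1 - {0}"
    by (auto simp: eventually_at dist_commute intro!: exI[of _ 1])
  with ev B(2) have "\<forall>\<^sub>F t in at 0. u (F t) \<le> ereal (\<nu> * ln (norm t) + (\<nu> * ln B + C'))"
  proof eventually_elim
    case (elim t)
    have t: "0 < norm t" "0 < norm (F t - F 0)" using elim(3) inj by auto
    have "ln (norm (F t - F 0)) \<le> ln (B * norm t)"
      using elim(2) t B(1) by (subst ln_le_cancel_iff) auto
    also have "\<dots> = ln B + ln (norm t)" using t B(1) by (simp add: ln_mult)
    finally have "\<nu> * ln (norm (F t - F 0)) \<le> \<nu> * ln B + \<nu> * ln (norm t)"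
      using \<open>0 < \<nu>\<close> by (metis distrib_left less_imp_le mult_left_mono)
    then show ?case
      using elim(1) by (cases "u (F t)") auto
  qed
  from plurisubharmonic_disc_log_bound[OF \<Omega> psh neg F F\<Omega> bound this \<open>0 < \<nu>\<close> T]
  show ?thesis .
qed

section \<open>Strictly convex domains filling the bidisc\<close>

lemma real_polynomial_function_frechet_derivative:
  assumes "real_polynomial_function f"
  shows "real_polynomial_function (\<lambda>x. frechet_derivative f (at x) v)"
  using assms
proof induction
  case (linear f)
  then have "frechet_derivative f (at x) = f" for x
    by (intro frechet_derivative_at[symmetric] bounded_linear_imp_has_derivative)
  then show ?case by (simp add: real_polynomial_function.intros(2))
next
  case (const c)
  then show ?case by (simp add: real_polynomial_function.intros(2))
next
  case (add f g)
  have "((\<lambda>x. f x + g x) has_derivative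
      (\<lambda>h. frechet_derivative f (at x) h + frechet_derivative g (at x) h)) (at x)" for x
    using add.hyps by (intro has_derivative_add)
      (simp_all add: differentiable_at_real_polynomial_function flip: frechet_derivative_works)
  then have "frechet_derivative (\<lambda>x. f x + g x) (at x)
      = (\<lambda>h. frechet_derivative f (at x) h + frechet_derivative g (at x) h)" for x
    by (intro frechet_derivative_at[symmetric])
  with add.IH show ?case by auto
next
  case (mult f g)
  have "((\<lambda>x. f x * g x) has_derivative
      (\<lambda>h. f x * frechet_derivative g (at x) h + frechet_derivative f (at x) h * g x)) (at x)" for x
    using mult.hyps by (intro has_derivative_mult)
      (simp_all add: differentiable_at_real_polynomial_function flip: frechet_derivative_works)
  then have "frechet_derivative (\<lambda>x. f x * g x) (at x)
      = (\<lambda>h. f x * frechet_derivative g (at x) h + frechet_derivative f (at x) h * g x)" for x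
    by (intro frechet_derivative_at[symmetric])
  with mult.IH mult.hyps show ?case by auto
qed

lemma smooth_on_real_polynomial_function:
  assumes "real_polynomial_function f"
  shows "smooth_on f U"
proof -
  have "Ck_on k f U" for k
    using assms
  proof (induction k arbitrary: f)
    case 0
    then show ?case
      by (auto intro!: continuous_at_imp_continuous_on continuous_real_polymonial_function)
  next
    case (Suc k)
    then show ?case
      by (simp add: differentiable_at_real_polynomial_function real_polynomial_function_frechet_derivative)
  qed
  then show ?thesis by (simp add: smooth_on_def)
qed

definition superellipse :: "nat \<Rightarrow> complex^2 \<Rightarrow> real" where
  "superellipse m z = norm (z $ 1) ^ (2 * m) + norm (z $ 2) ^ (2 * m) - 1"

lemma real_polynomial_superellipse: "real_polynomial_function (superellipse m)"
proof -
  have lin: "bounded_linear (\<lambda>z :: complex^2. Re (z $ i))" "bounded_linear (\<lambda>z :: complex^2. Im (z $ i))" for i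
    by (auto intro: bounded_linear_compose[OF bounded_linear_Re bounded_linear_vec_nth]
        bounded_linear_compose[OF bounded_linear_Im bounded_linear_vec_nth])
  have "superellipse m = (\<lambda>z. ((Re (z $ 1))\<^sup>2 + (Im (z $ 1))\<^sup>2) ^ m + ((Re (z $ 2))\<^sup>2 + (Im (z $ 2))\<^sup>2) ^ m - 1)"
    by (simp add: superellipse_def fun_eq_iff power_mult cmod_power2)
  moreover have "real_polynomial_function \<dots>"
    by (intro real_polynomial_function_diff real_polynomial_function.intros(3) real_polynomial_function_power
        real_polynomial_function.intros(1) real_polynomial_function.intros(2) lin)
  ultimately show ?thesis by simp
qed

text \<open>
The square of the norm is strictly convex by the parallelogram identity, and
\<open>x \<mapsto> x ^ m\<close> is increasing and convex on the nonnegative reals.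
\<close>

lemma norm_even_power_strictly_convex:
  fixes a b :: complex
  assumes "a \<noteq> b" "0 < t" "t < 1" "0 < m"
  shows "norm ((1 - t) *\<^sub>R a + t *\<^sub>R b) ^ (2 * m) < (1 - t) * norm a ^ (2 * m) + t * norm b ^ (2 * m)"
proof -
  have "(norm ((1 - t) *\<^sub>R a + t *\<^sub>R b))\<^sup>2
      = (1 - t) * (norm a)\<^sup>2 + t * (norm b)\<^sup>2 - t * (1 - t) * (norm (a - b))\<^sup>2"
    unfolding cmod_power2 by (simp add: power2_eq_square algebra_simps)
  moreover have "0 < t * (1 - t) * (norm (a - b))\<^sup>2"
    using assms by simp
  ultimately have "(norm ((1 - t) *\<^sub>R a + t *\<^sub>R b))\<^sup>2 < (1 - t) * (norm a)\<^sup>2 + t * (norm b)\<^sup>2"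
    by linarith
  then have "((norm ((1 - t) *\<^sub>R a + t *\<^sub>R b))\<^sup>2) ^ m < ((1 - t) * (norm a)\<^sup>2 + t * (norm b)\<^sup>2) ^ m"
    using \<open>0 < m\<close> by (intro power_strict_mono) auto
  also have "\<dots> \<le> (1 - t) * ((norm a)\<^sup>2) ^ m + t * ((norm b)\<^sup>2) ^ m"
  proof -
    have "convex_on {0..} (\<lambda>x::real. x ^ m)"
      using convex_power_odd[of m] convex_on_subset[OF convex_power_even[of m]] by (cases "even m") auto
    from convex_onD[OF this, of t "(norm a)\<^sup>2" "(norm b)\<^sup>2"] show ?thesis
      using assms by simp
  qed
  finally show ?thesis by (simp add: power_mult)
qed

lemma superellipse_strictly_convex:
  assumes "x \<noteq> y" "0 < t" "t < 1" "0 < m"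
  shows "superellipse m ((1 - t) *\<^sub>R x + t *\<^sub>R y) < (1 - t) * superellipse m x + t * superellipse m y"
proof -
  have le: "norm ((1 - t) *\<^sub>R a + t *\<^sub>R b) ^ (2 * m) \<le> (1 - t) * norm a ^ (2 * m) + t * norm b ^ (2 * m)"
    for a b :: complex
  proof (cases "a = b")
    case True
    have "(1 - t) *\<^sub>R b + t *\<^sub>R b = b" by (simp add: algebra_simps)
    then show ?thesis unfolding True by (simp add: algebra_simps)
  next
    case False
    then show ?thesis
      using norm_even_power_strictly_convex[OF False] assms by (intro less_imp_le) auto
  qed
  have "x $ 1 \<noteq> y $ 1 \<or> x $ 2 \<noteq> y $ 2"
    using assms(1) by (auto simp: vec_eq_iff forall_2)
  then show ?thesis
  proof
    assume "x $ 1 \<noteq> y $ 1"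
    from norm_even_power_strictly_convex[OF this assms(2-4)] le[of "x $ 2" "y $ 2"]
    show ?thesis by (simp add: superellipse_def algebra_simps)
  next
    assume "x $ 2 \<noteq> y $ 2"
    from norm_even_power_strictly_convex[OF this assms(2-4)] le[of "x $ 1" "y $ 1"]
    show ?thesis by (simp add: superellipse_def algebra_simps)
  qed
qed

lemma continuous_on_superellipse: "continuous_on S (superellipse m)"
  by (rule differentiable_imp_continuous_on)
    (rule differentiable_on_real_polynomial_function[OF real_polynomial_superellipse])

lemma open_superellipse: "open {z. superellipse m z < 0}"
  by (rule open_Collect_less[OF continuous_on_superellipse continuous_on_const])

lemma closure_superellipse: "closure {z. superellipse m z < 0} \<subseteq> {z. superellipse m z \<le> 0}"
  by (rule closure_minimal) (auto intro: closed_Collect_le[OF continuous_on_superellipse continuous_on_const])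

lemma superellipse_open_segment:
  assumes "0 < m" "x \<noteq> y" "superellipse m x \<le> 0" "superellipse m y \<le> 0"
  shows "open_segment x y \<subseteq> {z. superellipse m z < 0}"
proof
  fix z assume "z \<in> open_segment x y"
  then obtain t where t: "0 < t" "t < 1" "z = (1 - t) *\<^sub>R x + t *\<^sub>R y"
    using in_segment(2) by blast
  have "(1 - t) * superellipse m x + t * superellipse m y \<le> 0"
    using t assms by (intro add_nonpos_nonpos mult_nonneg_nonpos) auto
  then show "z \<in> {z. superellipse m z < 0}"
    using superellipse_strictly_convex[OF assms(2) t(1,2) assms(1)] t(3) by simp
qed

lemma strictly_convex_superellipse:
  assumes "0 < m"
  shows "strictly_convex {z. superellipse m z < 0}"
  unfolding strictly_convex_def interior_open[OF open_superellipse]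
proof (intro ballI impI)
  fix x y assume "x \<in> closure {z. superellipse m z < 0}" "y \<in> closure {z. superellipse m z < 0}" "x \<noteq> y"
  then show "open_segment x y \<subseteq> {z. superellipse m z < 0}"
    using superellipse_open_segment[OF assms] closure_superellipse[of m] by blast
qed

lemma is_domain_superellipse:
  assumes "0 < m"
  shows "is_domain {z. superellipse m z < 0}"
proof -
  have "convex {z. superellipse m z < 0}"
    unfolding convex_contains_open_segment
  proof (intro ballI)
    fix x y assume "x \<in> {z. superellipse m z < 0}" "y \<in> {z. superellipse m z < 0}"
    then show "open_segment x y \<subseteq> {z. superellipse m z < 0}"
      using superellipse_open_segment[OF assms, of x y] by (cases "x = y") auto
  qed
  moreover have "superellipse m 0 < 0"
    using assms by (simp add: superellipse_def power_0_left)
  ultimately show ?thesis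
    using open_superellipse convex_connected by (auto simp: is_domain_def)
qed

text \<open>
The gradient does not vanish on the boundary because
\<open>s \<mapsto> superellipse m (s *\<^sub>R p) = s ^ (2 * m) - 1\<close> has slope \<open>2 * m\<close> at \<open>s = 1\<close>.
\<close>

lemma smooth_boundary_superellipse:
  assumes "0 < m"
  shows "smooth_boundary {z. superellipse m z < 0}"
  unfolding smooth_boundary_def
proof
  fix p assume "p \<in> frontier {z. superellipse m z < 0}"
  then have p: "superellipse m p = 0"
    using closure_superellipse by (fastforce simp: frontier_def interior_open open_superellipse)
  have D: "(superellipse m has_derivative frechet_derivative (superellipse m) (at p)) (at p)"
    using differentiable_at_real_polynomial_function[OF real_polynomial_superellipse]
    by (simp flip: frechet_derivative_works)
  have "frechet_derivative (superellipse m) (at p) \<noteq> (\<lambda>_. 0)"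
  proof
    assume "frechet_derivative (superellipse m) (at p) = (\<lambda>_. 0)"
    with D have "(superellipse m has_derivative (\<lambda>_. 0)) (at (1 *\<^sub>R p))" by simp
    moreover have "((\<lambda>s::real. s *\<^sub>R p) has_derivative (\<lambda>s. s *\<^sub>R p)) (at 1)"
      by (intro bounded_linear_imp_has_derivative bounded_linear_scaleR_left)
    ultimately have "((\<lambda>s::real. superellipse m (s *\<^sub>R p)) has_derivative (\<lambda>_. 0)) (at 1)"
      using has_derivative_compose by fastforce
    moreover have "superellipse m (s *\<^sub>R p) = s ^ (2 * m) - 1" for s
    proof -
      have "norm (p $ 1) ^ (2 * m) + norm (p $ 2) ^ (2 * m) = 1"
        using p by (simp add: superellipse_def)
      then have "s ^ (2 * m) * (norm (p $ 1) ^ (2 * m) + norm (p $ 2) ^ (2 * m)) = s ^ (2 * m)"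
        by simp
      then show ?thesis
        by (simp add: superellipse_def power_mult_distrib power_even_abs algebra_simps)
    qed
    ultimately have "((\<lambda>s::real. s ^ (2 * m) - 1) has_real_derivative 0) (at 1)"
      by (simp add: has_field_derivative_def lambda_zero)
    moreover have "((\<lambda>s::real. s ^ (2 * m) - 1) has_real_derivative real (2 * m)) (at 1)"
      by (auto intro!: derivative_eq_intros)
    ultimately show False
      using DERIV_unique \<open>0 < m\<close> by fastforce
  qed
  then show "\<exists>U (\<rho> :: complex^2 \<Rightarrow> real). open U \<and> p \<in> U \<and> smooth_on \<rho> U \<and>
      frechet_derivative \<rho> (at p) \<noteq> (\<lambda>_. 0) \<and> {z. superellipse m z < 0} \<inter> U = {x\<in>U. \<rho> x < 0}"
    using smooth_on_real_polynomial_function[OF real_polynomial_superellipse[of m], of UNIV]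
    by (intro exI[of _ UNIV] exI[of _ "superellipse m"]) simp
qed

lemma superellipse_subset_bidisc:
  assumes "0 < m"
  shows "{z. superellipse m z < 0} \<subseteq> {z. z $ 1 \<in> ball 0 1 \<and> z $ 2 \<in> ball 0 1}"
proof
  fix z assume "z \<in> {z. superellipse m z < 0}"
  then have "norm (z $ 1) ^ (2 * m) + norm (z $ 2) ^ (2 * m) < 1"
    by (simp add: superellipse_def)
  moreover have "0 \<le> norm (z $ 1) ^ (2 * m)" "0 \<le> norm (z $ 2) ^ (2 * m)" by auto
  ultimately have "norm (z $ 1) ^ (2 * m) < 1" "norm (z $ 2) ^ (2 * m) < 1" by linarith+
  then show "z \<in> {z. z $ 1 \<in> ball 0 1 \<and> z $ 2 \<in> ball 0 1}"
    using assms by (simp add: power_less_one_iff)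
qed

lemma superellipse_contains_polydisc:
  fixes r :: real
  assumes "0 < r" "r < 1"
  obtains m where "0 < m" "\<And>z :: complex^2. norm (z $ 1) \<le> r \<Longrightarrow> norm (z $ 2) \<le> r \<Longrightarrow> superellipse m z < 0"
proof -
  have "r\<^sup>2 < 1" using assms by (simp add: power_less_one_iff)
  then obtain m where m: "(r\<^sup>2) ^ m < 1 / 2"
    using real_arch_pow_inv[of "1/2" "r\<^sup>2"] by auto
  have "0 < m" using m by (cases m) auto
  moreover have "superellipse m z < 0" if "norm (z $ 1) \<le> r" "norm (z $ 2) \<le> r" for z :: "complex^2"
    using power_mono[OF that(1), of "2 * m"] power_mono[OF that(2), of "2 * m"] m
    by (simp add: superellipse_def power_mult)
  ultimately show thesis by (rule that)
qed

section \<open>The Lempert function: discs in the bidisc\<close>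

text \<open>
The Schwarz lemma stated as a division, so that it can be iterated over several zeros: the quotient
is again bounded by 1 and keeps the remaining zeros.
\<close>

lemma Moebius_division:
  assumes f: "f holomorphic_on ball 0 1" and le: "\<And>z. z \<in> ball 0 1 \<Longrightarrow> norm (f z) \<le> 1"
    and p: "p \<in> ball 0 1" "f p = 0"
  obtains k where "k holomorphic_on ball 0 1" "\<And>z. z \<in> ball 0 1 \<Longrightarrow> norm (k z) \<le> 1"
    "\<And>z. z \<in> ball 0 1 \<Longrightarrow> f z = Moebius_function 0 p z * k z"
proof -
  let ?M = "Moebius_function 0 p" and ?M' = "Moebius_function 0 (- p)"
  have p1: "norm p < 1" "norm (- p) < 1" using p by auto
  have M: "?M z \<in> ball 0 1" "?M' z \<in> ball 0 1" "?M' (?M z) = z" if "z \<in> ball 0 1" for z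
    using that p1 Moebius_function_norm_lt_1 Moebius_function_compose[of "- p" p z] by auto
  define g where "g = (\<lambda>z. f (?M' z))"
  have "f \<circ> ?M' holomorphic_on ball 0 1"
    using M by (intro holomorphic_on_compose_gen[OF Moebius_function_holomorphic[OF p1(2)] f]) auto
  then have g: "g holomorphic_on ball 0 1" by (simp add: g_def o_def)
  have g0: "g 0 = 0" by (simp add: g_def Moebius_function_of_zero p)
  have g1: "norm (g z) \<le> 1" if "z \<in> ball 0 1" for z
    using le M that by (simp add: g_def)
  obtain h where h: "h holomorphic_on ball 0 1" "\<And>z. norm z < 1 \<Longrightarrow> g z = z * h z" "deriv g 0 = h 0"
    using Schwarz3[OF g g0] by blast
  have h1: "norm (h z) \<le> 1" if z: "norm z < 1" for z
  proof (rule field_le_mult_one_interval)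
    \<comment> \<open>the Schwarz lemma asks for values in the open disc, hence the factor \<open>c\<close>\<close>
    fix c :: real assume c: "0 < c" "c < 1"
    let ?g = "\<lambda>z. of_real c * g z"
    have hol: "?g holomorphic_on ball 0 1" by (intro holomorphic_intros g)
    have lt: "norm (?g w) < 1" if "norm w < 1" for w
    proof -
      have "c * norm (g w) \<le> c * 1" using g1 that c by (intro mult_left_mono) auto
      moreover have "norm (?g w) = c * norm (g w)" using c by (simp add: norm_mult)
      ultimately show ?thesis using c by linarith
    qed
    note Schwarz = Schwarz_Lemma[OF hol _ lt]
    show "c * norm (h z) \<le> 1"
    proof (cases "z = 0")
      case True
      have "deriv ?g 0 = of_real c * h 0"
        using holomorphic_on_imp_differentiable_at[OF g] h(3) by (simp add: deriv_cmult)
      then show ?thesis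
        using Schwarz(2)[of 0] g0 c by (simp add: True norm_mult)
    next
      case False
      have "norm (?g z) \<le> norm z" using Schwarz(1)[of z] g0 z by simp
      then have "c * (norm z * norm (h z)) \<le> norm z * 1"
        using h(2)[OF z] c by (simp add: norm_mult)
      then show ?thesis using False by (simp add: mult.left_commute)
    qed
  qed
  show thesis
  proof
    have "h \<circ> ?M holomorphic_on ball 0 1"
      using M by (intro holomorphic_on_compose_gen[OF Moebius_function_holomorphic[OF p1(1)] h(1)]) auto
    then show "(\<lambda>z. h (?M z)) holomorphic_on ball 0 1" by (simp add: o_def)
    fix z :: complex assume z: "z \<in> ball 0 1"
    show "norm (h (?M z)) \<le> 1" using h1 M(1)[OF z] by simp
    show "f z = ?M z * h (?M z)"
      using h(2)[of "?M z"] M[OF z] by (simp add: g_def)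
  qed
qed

lemma Moebius_function_nonzero:
  assumes "norm p < 1" "norm q < 1" "p \<noteq> q"
  shows "Moebius_function 0 p q \<noteq> 0"
  using assms Moebius_function_compose[of "- p" p q]
  by (auto simp: Moebius_function_of_zero)

lemma Schwarz_two_zeros:
  assumes f: "f holomorphic_on ball 0 1" and le: "\<And>z. z \<in> ball 0 1 \<Longrightarrow> norm (f z) \<le> 1"
    and p: "p \<in> ball 0 1" "f p = 0" and q: "q \<in> ball 0 1" "f q = 0" and "p \<noteq> q" and z: "z \<in> ball 0 1"
  shows "norm (f z) \<le> norm (Moebius_function 0 p z) * norm (Moebius_function 0 q z)"
proof -
  obtain k where k: "k holomorphic_on ball 0 1" "\<And>z. z \<in> ball 0 1 \<Longrightarrow> norm (k z) \<le> 1"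
    "\<And>z. z \<in> ball 0 1 \<Longrightarrow> f z = Moebius_function 0 p z * k z"
    using Moebius_division[OF f le p] by blast
  have "k q = 0"
    using k(3)[OF q(1)] q Moebius_function_nonzero[of p q] p \<open>p \<noteq> q\<close> by simp
  then obtain l where l: "\<And>z. z \<in> ball 0 1 \<Longrightarrow> norm (l z) \<le> 1"
    "\<And>z. z \<in> ball 0 1 \<Longrightarrow> k z = Moebius_function 0 q z * l z"
    using Moebius_division[OF k(1,2) q(1)] by metis
  have "norm (f z) = norm (Moebius_function 0 p z) * norm (Moebius_function 0 q z) * norm (l z)"
    using k(3)[OF z] l(2)[OF z] by (simp add: norm_mult)
  also have "\<dots> \<le> norm (Moebius_function 0 p z) * norm (Moebius_function 0 q z) * 1"
    using l(1)[OF z] by (intro mult_left_mono) auto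
  finally show ?thesis by simp
qed

text \<open>
Here \<open>x\<close> and \<open>y\<close> are the moduli of the two preimages and \<open>\<rho>\<close> is their pseudohyperbolic
distance.  If \<open>y \<ge> \<theta>\<close>, the bound follows from \<open>w \<le> x * y\<close>.  Otherwise the constraint
\<open>\<beta> \<le> y * \<rho>\<close> together with \<open>\<rho> \<le> (x + y) / (1 - x * y)\<close> forces \<open>x \<ge> (\<beta> - \<theta>\<^sup>2) / 2\<close>,
a bound independent of \<open>w\<close>, which suffices for small \<open>w\<close>.  Any \<open>\<theta> < sqrt \<beta>\<close> is
possible, whereas the Green function only sees \<open>\<beta>\<close>, which is smaller.
\<close>

lemma weighted_product_lower_bound:
  fixes x y :: real
  assumes x: "0 \<le> x" "x \<le> 1" and y: "0 \<le> y" "y \<le> 1"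
    and w: "w \<le> x * y" and \<beta>: "0 < \<beta>" "\<beta> \<le> 1" "\<beta> \<le> y * \<rho>"
    and \<rho>: "0 \<le> \<rho>" "\<rho> \<le> 1" "\<rho> * (1 - x * y) \<le> x + y"
    and \<theta>: "0 < \<theta>" "\<theta>\<^sup>2 < \<beta>" "w * \<theta> \<le> (\<beta> - \<theta>\<^sup>2) * \<beta>\<^sup>2 / 2"
  shows "w * \<theta> \<le> x * y\<^sup>2"
proof (cases "\<theta> \<le> y")
  case True
  have "w * \<theta> \<le> (x * y) * \<theta>" using w \<theta> by (intro mult_right_mono) auto
  also have "\<dots> \<le> (x * y) * y" using True x y by (intro mult_left_mono) auto
  finally show ?thesis by (simp add: power2_eq_square)
next
  case False
  have xy: "x * y \<le> x" using mult_left_le[of y x] x y by simp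
  have "x * y \<le> 1" using xy x by simp
  then have "\<beta> * (1 - x * y) \<le> (y * \<rho>) * (1 - x * y)"
    using \<beta> by (intro mult_right_mono) auto
  also have "\<dots> \<le> y * (x + y)"
    using mult_left_mono[OF \<rho>(3) y(1)] by (simp add: mult.assoc)
  finally have 1: "\<beta> - \<beta> * (x * y) \<le> x * y + y\<^sup>2"
    by (simp add: algebra_simps power2_eq_square)
  have "\<beta> * (x * y) \<le> 1 * (x * y)"
    using \<beta> x y by (intro mult_right_mono) auto
  moreover have "y\<^sup>2 \<le> \<theta>\<^sup>2" using False y by (intro power_mono) auto
  ultimately have "(\<beta> - \<theta>\<^sup>2) / 2 \<le> x" using 1 xy by simp
  moreover have "\<beta> \<le> y" using \<beta>(3) mult_left_le[of \<rho> y] \<rho> y by simp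
  ultimately have "(\<beta> - \<theta>\<^sup>2) / 2 * \<beta>\<^sup>2 \<le> x * y\<^sup>2"
    using x \<beta> by (intro mult_mono power_mono) auto
  then show ?thesis using \<theta> by simp
qed

text \<open>
The second component vanishes at \<open>p\<close> and \<open>q\<close>, which gives \<open>w \<le> norm p * norm q\<close>.  The
first component takes the value \<open>a\<close> at 0 and at \<open>p\<close>, because the base point lies over the
pole \<open>(a, 0)\<close>; so its Moebius image vanishes at both, and evaluating at \<open>q\<close> gives the
constraint that couples \<open>p\<close> and \<open>q\<close>.
\<close>

lemma bidisc_disc_lower_bound:
  assumes f1: "f1 holomorphic_on ball 0 1" "f1 ` ball 0 1 \<subseteq> ball 0 1"
    and f2: "f2 holomorphic_on ball 0 1" "f2 ` ball 0 1 \<subseteq> ball 0 1"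
    and ab: "norm a < 1" "norm b < 1" "a \<noteq> b" and "0 < w"
    and f0: "f1 0 = a" "f2 0 = of_real w"
    and p: "p \<in> ball 0 1" "f1 p = a" "f2 p = 0"
    and q: "q \<in> ball 0 1" "f1 q = b" "f2 q = 0"
    and \<theta>: "0 < \<theta>" "\<theta>\<^sup>2 < norm (Moebius_function 0 a b)"
      "w * \<theta> \<le> (norm (Moebius_function 0 a b) - \<theta>\<^sup>2) * (norm (Moebius_function 0 a b))\<^sup>2 / 2"
  shows "w * \<theta> \<le> norm p * (norm q)\<^sup>2"
proof -
  have neq: "p \<noteq> 0" "q \<noteq> 0" "p \<noteq> q" using f0 p q ab \<open>0 < w\<close> by auto
  let ?\<rho> = "norm (Moebius_function 0 p q)"
  let ?\<beta> = "norm (Moebius_function 0 a b)"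
  have \<beta>: "0 < ?\<beta>" "?\<beta> \<le> 1"
    using Moebius_function_nonzero[OF ab] Moebius_function_norm_lt_1[OF ab(1,2)] by (auto simp: less_imp_le)
  have f2_le: "norm (f2 z) \<le> 1" if "z \<in> ball 0 1" for z
    using f2(2) that by (force intro: less_imp_le)
  have "norm (f2 0) \<le> norm (Moebius_function 0 p 0) * norm (Moebius_function 0 q 0)"
    by (rule Schwarz_two_zeros[OF f2(1) f2_le p(1,3) q(1,3) neq(3)]) auto
  then have w: "w \<le> norm p * norm q"
    using \<open>0 < w\<close> by (simp add: f0 Moebius_function_of_zero)
  define g where "g = Moebius_function 0 a \<circ> f1"
  have g: "g holomorphic_on ball 0 1"
    unfolding g_def by (intro holomorphic_on_compose_gen[OF f1(1) Moebius_function_holomorphic[OF ab(1)] f1(2)])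
  have g_le: "norm (g z) \<le> 1" if "z \<in> ball 0 1" for z
  proof -
    have "f1 z \<in> ball 0 1" using f1(2) that by blast
    then have "norm (f1 z) < 1" by simp
    then show ?thesis
      using Moebius_function_norm_lt_1[OF ab(1)] by (simp add: g_def less_imp_le)
  qed
  have "norm (g q) \<le> norm (Moebius_function 0 0 q) * norm (Moebius_function 0 p q)"
    using neq p q f0 by (intro Schwarz_two_zeros[OF g g_le]) (auto simp: g_def Moebius_function_eq_zero)
  then have \<beta>q: "?\<beta> \<le> norm q * ?\<rho>"
    by (simp add: g_def q Moebius_function_simple)
  have "?\<rho> * (1 - norm p * norm q) \<le> norm p + norm q"
  proof -
    have "norm (cnj p * q) < 1" using p q by (metis complex_mod_cnj mem_ball_0 norm_mult_less mult_1)
    then have "0 < 1 - norm p * norm q" "1 - norm p * norm q \<le> norm (1 - cnj p * q)"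
      using norm_triangle_ineq2[of 1 "cnj p * q"] by (auto simp: norm_mult)
    then have "?\<rho> * (1 - norm p * norm q) \<le> ?\<rho> * norm (1 - cnj p * q)"
      by (intro mult_left_mono) auto
    also have "\<dots> = norm (q - p)"
      using \<open>norm (cnj p * q) < 1\<close> by (auto simp: Moebius_function_simple norm_divide)
    also have "\<dots> \<le> norm p + norm q"
      using norm_triangle_ineq4[of q p] by simp
    finally show ?thesis .
  qed
  moreover have "?\<rho> \<le> 1" using Moebius_function_norm_lt_1[of p q 0] p q by simp
  ultimately show ?thesis
    using p(1) q(1) w \<beta> \<beta>q \<theta> by (intro weighted_product_lower_bound[where \<beta> = ?\<beta> and \<rho> = ?\<rho>]) auto
qed

section \<open>The Green function, and the strict inequality\<close>

text \<open>
With \<open>T\<close> the pseudohyperbolic coordinate of \<open>a\<close> relative to \<open>b\<close> in the disc of radius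
\<open>r\<close> and \<open>M\<close> the Moebius map taking 0 to \<open>b / r\<close>, each disc \<open>t \<mapsto> (r * M t, c * t)\<close> passes through \<open>(b, 0)\<close> at \<open>t = 0\<close>
and through \<open>(a, c * T)\<close> at \<open>t = T\<close>, which bounds members of the Green family by
\<open>2 * ln (norm T)\<close> there.  As \<open>c\<close> varies these points fill a punctured disc of radius
\<open>r * norm T\<close> in the line over \<open>a\<close>, whose centre is the pole \<open>(a, 0)\<close> of weight 1; the
disc bound applied in this line adds \<open>ln (w / (r * norm T))\<close>.
\<close>

lemma green_function_upper_bound:
  fixes \<Omega> :: "(complex^2) set" and r w :: real and a b :: complex
  assumes \<Omega>: "open \<Omega>" and r: "0 < r" "r < 1" "norm a < r" "norm b < r" "a \<noteq> b"
    and polydisc: "\<And>z :: complex^2. norm (z $ 1) \<le> r \<Longrightarrow> norm (z $ 2) \<le> r \<Longrightarrow> z \<in> \<Omega>"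
    and A: "(vector [a, 0], 1) \<in> A" "(vector [b, 0], 2) \<in> A"
    and w: "0 < w" "w < r * norm (Moebius_function 0 (b / r) (a / r))"
  shows "green_function \<Omega> A (vector [a, of_real w])
    \<le> ereal (ln (w * norm (Moebius_function 0 (b / r) (a / r)) / r))"
proof -
  define T where "T = Moebius_function 0 (b / r) (a / r)"
  have ab: "norm (a / r) < 1" "norm (b / r) < 1" "b / r \<noteq> a / r"
    using r by (auto simp: norm_divide)
  have T: "T \<in> ball 0 1 - {0}"
    using Moebius_function_norm_lt_1[OF ab(2,1)] Moebius_function_nonzero[OF ab(2,1,3)] by (simp add: T_def)
  let ?M = "Moebius_function 0 (- (b / r))"
  have M: "norm (?M t) < 1" if "norm t < 1" for t
    using Moebius_function_norm_lt_1[of "- (b / r)" t] ab that by simp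
  have MT: "?M T = a / r"
    unfolding T_def using ab by (intro Moebius_function_compose) auto
  have hol: "(\<lambda>t. vector [g t, h t] $ i) holomorphic_on ball 0 1"
    if "g holomorphic_on ball 0 1" "h holomorphic_on ball 0 1" for g h :: "complex \<Rightarrow> complex" and i :: 2
    using that exhaust_2[of i] by auto
  have "u (vector [a, of_real w]) \<le> ereal (ln (w * norm T / r))" if u: "u \<in> green_family \<Omega> A" for u
  proof -
    have circle: "u (vector [a, c * T]) \<le> ereal (2 * ln (norm T))" if c: "c \<noteq> 0" "norm c \<le> r" for c
    proof -
      let ?F = "\<lambda>t. vector [of_real r * ?M t, c * t] :: complex^2"
      have F0: "?F 0 = vector [b, 0]" using r by (simp add: Moebius_function_of_zero)
      have "u (?F T) \<le> ereal (0 + 2 * ln (norm T))"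
      proof (rule green_family_disc_bound[OF \<Omega> u, where F = ?F])
        show "(?F 0, 2) \<in> A" using A F0 by simp
        show "(\<lambda>t. ?F t $ i) holomorphic_on ball 0 1" for i
          using ab(2) by (intro hol holomorphic_intros Moebius_function_holomorphic) simp
        show "?F ` ball 0 1 \<subseteq> \<Omega>"
        proof
          fix z assume "z \<in> ?F ` ball 0 1"
          then obtain t where t: "norm t < 1" "z = ?F t" by auto
          have "r * norm (?M t) \<le> r * 1" using M[OF t(1)] r by (intro mult_left_mono) auto
          moreover have "norm c * norm t \<le> r * 1" using t c r by (intro mult_mono) auto
          ultimately show "z \<in> \<Omega>"
            unfolding t(2) using r by (intro polydisc) (simp_all add: norm_mult)
        qed
        then show "u (?F t) \<le> ereal 0" if "t \<in> ball 0 1 - {0}" for t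
        proof -
          have "?F t \<in> \<Omega>" using \<open>?F ` ball 0 1 \<subseteq> \<Omega>\<close> that by blast
          then show ?thesis
            using u unfolding green_family_def zero_ereal_def[symmetric] by blast
        qed
        show "?F t \<noteq> ?F 0" if "t \<in> ball 0 1 - {0}" for t
          using that c by (auto simp: vec_eq_iff forall_2)
      qed (use T in auto)
      then show ?thesis using r by (simp add: MT)
    qed
    let ?S = "\<lambda>t. vector [a, of_real r * t * T] :: complex^2"
    define t where "t = of_real w / (of_real r * T)"
    have t: "t \<in> ball 0 1 - {0}"
      using w r T by (auto simp: t_def norm_divide norm_mult T_def[symmetric])
    have rT: "norm (of_real r * s * T) \<le> r" if "norm s < 1" for s
    proof -
      have "norm s * norm T \<le> 1 * 1" using that T by (intro mult_mono) auto
      then have "r * (norm s * norm T) \<le> r * 1" using r by (intro mult_left_mono) auto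
      then show ?thesis using r by (simp add: norm_mult mult.assoc)
    qed
    have "u (?S t) \<le> ereal (2 * ln (norm T) + 1 * ln (norm t))"
    proof (rule green_family_disc_bound[OF \<Omega> u, where F = ?S])
      show "(?S 0, 1) \<in> A" using A by simp
      show "(\<lambda>t. ?S t $ i) holomorphic_on ball 0 1" for i
        by (intro hol holomorphic_intros)
      show "?S ` ball 0 1 \<subseteq> \<Omega>"
        using rT r by (auto intro!: polydisc)
      show "u (?S s) \<le> ereal (2 * ln (norm T))" if "s \<in> ball 0 1 - {0}" for s
      proof (rule circle)
        show "of_real r * s \<noteq> 0" using that r by simp
        show "norm (of_real r * s) \<le> r" using that r by (simp add: norm_mult mult_left_le)
      qed
      show "?S s \<noteq> ?S 0" if "s \<in> ball 0 1 - {0}" for s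
        using that T r by (auto simp: vec_eq_iff forall_2)
    qed (use t in auto)
    moreover have "?S t = vector [a, of_real w]"
      using T r by (simp add: t_def)
    moreover have "2 * ln (norm T) + 1 * ln (norm t) = ln (w * norm T / r)"
      using T r w by (simp add: t_def norm_divide norm_mult ln_div ln_mult)
    ultimately show ?thesis by simp
  qed
  then show ?thesis
    unfolding green_function_def T_def by (rule SUP_least)
qed

lemma lempert_function_lower_bound:
  fixes \<Omega> :: "(complex^2) set" and w :: real and a b :: complex
  assumes \<Omega>: "\<Omega> \<subseteq> {z. z $ 1 \<in> ball 0 1 \<and> z $ 2 \<in> ball 0 1}"
    and ab: "norm a < 1" "norm b < 1" "a \<noteq> b" and "0 < w"
    and \<theta>: "0 < \<theta>" "\<theta>\<^sup>2 < norm (Moebius_function 0 a b)"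
      "w * \<theta> \<le> (norm (Moebius_function 0 a b) - \<theta>\<^sup>2) * (norm (Moebius_function 0 a b))\<^sup>2 / 2"
  shows "ereal (ln (w * \<theta>))
    \<le> lempert_function \<Omega> {(vector [a, 0], 1), (vector [b, 0], 2)} (vector [a, of_real w])"
  unfolding lempert_function_def
proof (rule INF_greatest, clarify)
  let ?P = "(vector [a, 0] :: complex^2, 1 :: real)" and ?Q = "(vector [b, 0] :: complex^2, 2 :: real)"
  fix f \<zeta> assume "(f, \<zeta>) \<in> lempert_discs \<Omega> {?P, ?Q} (vector [a, of_real w])"
  then have hol: "\<And>i. (\<lambda>t. f t $ i) holomorphic_on ball 0 1" and f\<Omega>: "f ` ball 0 1 \<subseteq> \<Omega>"
    and f0: "f 0 = vector [a, of_real w]"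
    and p: "\<zeta> ?P \<in> ball 0 1" "f (\<zeta> ?P) = vector [a, 0]"
    and q: "\<zeta> ?Q \<in> ball 0 1" "f (\<zeta> ?Q) = vector [b, 0]"
    by (auto simp: lempert_discs_def)
  have "w * \<theta> \<le> norm (\<zeta> ?P) * (norm (\<zeta> ?Q))\<^sup>2"
  proof (rule bidisc_disc_lower_bound[OF hol[of 1] _ hol[of 2] _ ab \<open>0 < w\<close>])
    show "(\<lambda>t. f t $ 1) ` ball 0 1 \<subseteq> ball 0 1" "(\<lambda>t. f t $ 2) ` ball 0 1 \<subseteq> ball 0 1"
      using f\<Omega> \<Omega> by blast+
  qed (use f0 p q \<theta> in auto)
  moreover have ne: "?P \<noteq> ?Q" by simp
  have nz: "\<zeta> ?P \<noteq> 0" "\<zeta> ?Q \<noteq> 0"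
  proof -
    have "vector [a, of_real w] \<noteq> (vector [x, 0] :: complex^2)" for x
      using \<open>0 < w\<close> by (auto simp: vec_eq_iff forall_2)
    then show "\<zeta> ?P \<noteq> 0" "\<zeta> ?Q \<noteq> 0" using f0 p(2) q(2) by metis+
  qed
  ultimately have "ln (w * \<theta>) \<le> ln (norm (\<zeta> ?P) * (norm (\<zeta> ?Q))\<^sup>2)"
    using \<open>0 < w\<close> \<theta>(1) by (subst ln_le_cancel_iff) auto
  also have "\<dots> = ln (norm (\<zeta> ?P)) + 2 * ln (norm (\<zeta> ?Q))"
    using nz by (simp add: ln_mult ln_realpow)
  finally show "ereal (ln (w * \<theta>)) \<le> (\<Sum>p\<in>{?P, ?Q}. ereal (snd p) * log_ereal (norm (\<zeta> p)))"
    using ne nz by (simp add: log_ereal_def)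
qed

theorem mainTheorem8:
  fixes a b :: complex
  assumes "a \<in> ball 0 1 - {0}" and "b \<in> ball 0 1 - {0}" and "a \<noteq> b"
  defines "A \<equiv> {(vector [a, 0] :: complex^2, 1 :: real), (vector [b, 0], 2)}"
  shows "\<exists>\<Omega> :: (complex^2) set.
           is_domain \<Omega> \<and> strictly_convex \<Omega> \<and> smooth_boundary \<Omega> \<and>
           \<Omega> \<subseteq> {z. z $ 1 \<in> ball 0 1 \<and> z $ 2 \<in> ball 0 1} \<and>
           vector [a, 0] \<in> \<Omega> \<and> vector [b, 0] \<in> \<Omega> \<and>
           (\<exists>z\<in>\<Omega>. green_function \<Omega> A z \<noteq> lempert_function \<Omega> A z)"
proof -
  have a: "norm a < 1" and b: "norm b < 1" using assms by auto
  define \<beta> where "\<beta> = norm (Moebius_function 0 a b)"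
  have \<beta>: "0 < \<beta>" "\<beta> < 1"
    using Moebius_function_norm_lt_1[OF a b] Moebius_function_nonzero[OF a b \<open>a \<noteq> b\<close>] by (auto simp: \<beta>_def)
  have "\<beta> < sqrt \<beta>"
    using \<beta> by (simp add: real_less_rsqrt power2_eq_square)
  \<comment> \<open>up to terms tending to 0 as \<open>r \<rightarrow> 1\<close>, the Green function is at most \<open>ln (w * \<beta>)\<close>, the Lempert function at least \<open>ln (w * \<theta>)\<close>\<close>
  then obtain \<theta> where \<theta>: "\<beta> < \<theta>" "\<theta> < sqrt \<beta>" using dense by blast
  have "0 < \<theta>" using \<theta> \<beta> by simp
  have "\<theta>\<^sup>2 < (sqrt \<beta>)\<^sup>2" using \<theta> \<open>0 < \<theta>\<close> by (intro power_strict_mono) auto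
  then have \<theta>2: "\<theta>\<^sup>2 < \<beta>" using \<beta> by simp
  let ?\<tau> = "\<lambda>r::real. norm (Moebius_function 0 (b / r) (a / r))"
  have "((\<lambda>r. ?\<tau> r / r) \<longlongrightarrow> norm (Moebius_function 0 b a) / 1) (at_left 1)"
  proof -
    have "norm (cnj b * a) < 1" using a b by (metis complex_mod_cnj norm_mult_less mult_1)
    then have "1 - cnj b * a \<noteq> 0" by auto
    then show ?thesis
      unfolding Moebius_function_simple by (auto intro!: tendsto_eq_intros)
  qed
  moreover have "norm (Moebius_function 0 b a) = \<beta>"
  proof -
    have "norm (1 - cnj b * a) = norm (1 - cnj a * b)"
      using complex_mod_cnj[of "1 - cnj b * a"] by (simp add: mult.commute)
    then show ?thesis by (simp add: \<beta>_def Moebius_function_simple norm_divide norm_minus_commute)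
  qed
  ultimately have "((\<lambda>r. ?\<tau> r / r) \<longlongrightarrow> \<beta>) (at_left 1)" by simp
  from order_tendstoD(2)[OF this \<theta>(1)]
  have ev: "\<forall>\<^sub>F r in at_left 1. ?\<tau> r / r < \<theta>" .
  have "max (norm a) (norm b) < 1" using a b by simp
  then have "\<forall>\<^sub>F r in at_left 1. r \<in> {max (norm a) (norm b)<..<1}"
    by (rule eventually_at_left_real)
  with ev have "\<forall>\<^sub>F r in at_left 1. ?\<tau> r / r < \<theta> \<and> r \<in> {max (norm a) (norm b)<..<1}"
    by (rule eventually_conj)
  from eventually_happens[OF this] obtain r
    where r: "?\<tau> r / r < \<theta>" "norm a < r" "norm b < r" "r < 1"
    by (auto simp: trivial_limit_at_left_real)
  have "0 < r" using r(2) norm_ge_zero[of a] by linarith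
  have \<tau>: "0 < ?\<tau> r"
    using Moebius_function_nonzero[of "b / r" "a / r"] r \<open>0 < r\<close> \<open>a \<noteq> b\<close> by (auto simp: norm_divide)
  define w where "w = min (r * ?\<tau> r / 2) ((\<beta> - \<theta>\<^sup>2) * \<beta>\<^sup>2 / (2 * \<theta>))"
  have w: "0 < w" "w < r * ?\<tau> r" "w * \<theta> \<le> (\<beta> - \<theta>\<^sup>2) * \<beta>\<^sup>2 / 2"
  proof -
    show "0 < w" using \<tau> \<open>0 < r\<close> \<beta> \<theta>2 \<open>0 < \<theta>\<close> by (simp add: w_def)
    have "w \<le> r * ?\<tau> r / 2" by (simp add: w_def)
    moreover have "0 < r * ?\<tau> r" using \<tau> \<open>0 < r\<close> by simp
    ultimately show "w < r * ?\<tau> r" by linarith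
    have "w \<le> (\<beta> - \<theta>\<^sup>2) * \<beta>\<^sup>2 / (2 * \<theta>)" by (simp add: w_def)
    then show "w * \<theta> \<le> (\<beta> - \<theta>\<^sup>2) * \<beta>\<^sup>2 / 2" using \<open>0 < \<theta>\<close> by (simp add: field_simps)
  qed
  obtain m where m: "0 < m"
    "\<And>z :: complex^2. norm (z $ 1) \<le> r \<Longrightarrow> norm (z $ 2) \<le> r \<Longrightarrow> superellipse m z < 0"
    using superellipse_contains_polydisc[OF \<open>0 < r\<close> \<open>r < 1\<close>] by blast
  define \<Omega> where "\<Omega> = {z. superellipse m z < 0}"
  have polydisc: "z \<in> \<Omega>" if "norm (z $ 1) \<le> r" "norm (z $ 2) \<le> r" for z :: "complex^2"
    using m(2) that by (simp add: \<Omega>_def)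
  have "w \<le> r"
  proof -
    have "?\<tau> r < 1" using Moebius_function_norm_lt_1[of "b / r" "a / r"] r \<open>0 < r\<close> by (simp add: norm_divide)
    then have "r * ?\<tau> r \<le> r * 1" using \<open>0 < r\<close> by (intro mult_left_mono) auto
    then show ?thesis using w(2) by simp
  qed
  have "green_function \<Omega> A (vector [a, of_real w]) \<le> ereal (ln (w * ?\<tau> r / r))"
    using r \<open>0 < r\<close> \<open>a \<noteq> b\<close> w polydisc open_superellipse
    by (intro green_function_upper_bound) (auto simp: A_def \<Omega>_def)
  also have "\<dots> < ereal (ln (w * \<theta>))"
  proof -
    have "w * (?\<tau> r / r) < w * \<theta>" using r(1) w(1) by (intro mult_strict_left_mono)
    moreover have "0 < w * (?\<tau> r / r)" using w \<tau> \<open>0 < r\<close> by simp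
    ultimately show ?thesis using ln_less_cancel_iff by simp
  qed
  also have "\<dots> \<le> lempert_function \<Omega> A (vector [a, of_real w])"
    unfolding A_def
    using superellipse_subset_bidisc[OF m(1)] a b \<open>a \<noteq> b\<close> w \<open>0 < \<theta>\<close> \<theta>2
    by (intro lempert_function_lower_bound) (auto simp: \<Omega>_def \<beta>_def)
  finally have "green_function \<Omega> A (vector [a, of_real w]) \<noteq> lempert_function \<Omega> A (vector [a, of_real w])"
    by simp
  moreover have "vector [a, of_real w] \<in> \<Omega>" "vector [a, 0] \<in> \<Omega>" "vector [b, 0] \<in> \<Omega>"
    using r \<open>0 < r\<close> \<open>w \<le> r\<close> w(1) by (auto intro!: polydisc)
  moreover have "is_domain \<Omega>" "strictly_convex \<Omega>" "smooth_boundary \<Omega>"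
    "\<Omega> \<subseteq> {z. z $ 1 \<in> ball 0 1 \<and> z $ 2 \<in> ball 0 1}"
    unfolding \<Omega>_def
    using is_domain_superellipse[OF m(1)] strictly_convex_superellipse[OF m(1)]
      smooth_boundary_superellipse[OF m(1)] superellipse_subset_bidisc[OF m(1)] by blast+
  ultimately show ?thesis by blast
qed

end
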